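(* Let the coefficients be random stationary ergodic as described in the context, with $d'_i=d_{i+1}$, and let $\underline{\omega}(\omega),\overline{\omega}(\omega)$ be the associated speeds for the event $\omega$. Then there is a measurable set $\Omega'\subset\Omega$ with $\mathbb P(\Omega')=1$ such that $\overline{\omega}(\cdot)=\underline{\omega}(\cdot)$ on $\Omega'$ and this common function is constant on $\Omega'$.
   Context: Random setting. $(\Omega,\mathcal F,\mathbb P)$ is a probability space; $f:\mathbf Z\times[0,1]\times\Omega\to\mathbf R$, $(i,s;\omega)\mapsto f(i,s;\omega)$ and $d:\mathbf Z\times\Omega\to(0,+\infty)$ are random variables (measurable in $\omega$). There is $\Omega_0\subset\Omega$ with $\mathbb P(\Omega_0)=1$ such that for each fixed $\omega\in\Omega_0$: $0<\inf_i d(i,\omega)\le\sup_i d(i,\omega)<\infty$; $\sup_i\|f(i,\cdot;\omega)\|_{C^{1+\alpha}([0,1])}<\infty$ for some Hölder exponent $\alpha\in(0,1]$; $f(i,0;\omega)=f(i,1;\omega)=0$; $0<\inf_j f(j,s;\omega)\le f(i,s;\omega)\le f'_s(i,0;\omega)s$ for all $i$ and $s\in(0,1)$; $\liminf_{|i|\to\infty}\big(f'_s(i,0;\omega)-(\sqrt{d(i+1,\omega)}-\sqrt{d(i,\omega)})^2\big)>0$. Write $d_i(\omega)=d(i,\omega)$ and $c_i(\omega)=c(i,\omega)=f'_s(i,0;\omega)$. The functions $c,d$ are random stationary ergodic: there is a group $(\pi_i)_{i\in\mathbf Z}$ of measure-preserving transformations acting ergodically on $\Omega$ with $c(i+j,\omega)=c(i,\pi_j\omega)$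 and $d(i+j,\omega)=d(i,\pi_j\omega)$ for all $i,j\in\mathbf Z$, $\omega\in\Omega$. Operators. For $n\in\mathbf Z$, $X_n$ is the set of functions $[n,+\infty)\cap\mathbf Z\to\mathbf R$. For $\phi\in X_n$ and $i>n$, $(\mathcal L^\omega\phi)_i=d_{i+1}(\omega)(\phi_{i+1}-\phi_i)+d_i(\omega)(\phi_{i-1}-\phi_i)+c_i(\omega)\phi_i$, and for $p\in\mathbf R$, $(L^\omega_p\phi)_i=e^{-pi}(\mathcal L^\omega(e^{p\cdot}\phi))_i$, where $(e^{p\cdot}\phi)_j=e^{pj}\phi_j$. Generalized principal eigenvalues. For $n\in\mathbf Z$ let $I_n=(n,+\infty)\cap\mathbf Z$ and let $\mathcal A_n$ be the set of $\phi\in X_n$ with $\phi_i>0$ for $i\ge n$, $\lim_{i\to+\infty}\frac{\ln\phi_i}{i}=0$, and both sequences $\big(\frac{\phi_{i+1}-\phi_i}{\phi_i}\big)_{i\ge n}$, $\big(\frac{\phi_{i+1}-\phi_i}{\phi_{i+1}}\big)_{i\ge n}$ bounded. Define $$\underline{\lambda_1}(p,n;\omega)=\sup\{\lambda:\exists\phi\in\mathcal A_n,\ (L^\omega_p\phi)_i\ge\lambda\phi_i\ \forall i\in I_n\},\quad \overline{\lambda_1}(p,n;\omega)=\inf\{\lambda:\exists\phi\in\mathcal A_n,\ (L^\omega_p\phi)_i\le\lambda\phi_i\ \forall i\in I_n\},$$ which are respectively nondecreasing and nonincreasing in $n$. Speeds. $\underline H(p,\omega)=\lim_{n\to+\infty}\underline{\lambda_1}(p,n;\omega)$,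 $\overline H(p,\omega)=\lim_{n\to+\infty}\overline{\lambda_1}(p,n;\omega)$, $\underline{\omega}(\omega)=\min_{p>0}\frac{\underline H(-p,\omega)}{p}$, $\overline{\omega}(\omega)=\min_{p>0}\frac{\overline H(-p,\omega)}{p}$. *)

theory Defs
  imports "HOL-Probability.Probability"
begin

definition deriv01 :: "(real \<Rightarrow> real) \<Rightarrow> real \<Rightarrow> real" where
  "deriv01 g s = vector_derivative g (at s within {0..1})"

text \<open>The norm of \<open>C\<^sup>1\<^sup>+\<^sup>\<alpha>([0,1])\<close>, with value \<open>\<infinity>\<close> outside that space. Finiteness of the Hoelder
  seminorm of the derivative makes the derivative continuous.\<close>

definition C1_Holder_norm :: "real \<Rightarrow> (real \<Rightarrow> real) \<Rightarrow> ennreal" where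
  "C1_Holder_norm \<alpha> g =
    (if g differentiable_on {0..1} then
       (SUP s\<in>{0..1}. ennreal \<bar>g s\<bar>)
     + (SUP s\<in>{0..1}. ennreal \<bar>deriv01 g s\<bar>)
     + (SUP (s, t)\<in>{(s, t). s \<in> {0..1} \<and> t \<in> {0..1} \<and> s \<noteq> t}.
          ennreal (\<bar>deriv01 g s - deriv01 g t\<bar> / \<bar>s - t\<bar> powr \<alpha>))
     else \<infinity>)"

text \<open>The conditions on the coefficients for a fixed event. Infima, suprema and the lower limit are
  taken in the extended reals; the filter \<open>filtercomap abs at_top\<close> on the integers is
  \<open>\<bar>i\<bar> \<rightarrow> \<infinity>\<close>.\<close>

definition admissible_coeffs :: "(int \<Rightarrow> real \<Rightarrow> real) \<Rightarrow> (int \<Rightarrow> real) \<Rightarrow> bool" where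
  "admissible_coeffs g d \<longleftrightarrow>
     0 < (INF i. ereal (d i)) \<and> (SUP i. ereal (d i)) < \<infinity> \<and>
     (\<exists>\<alpha>. 0 < \<alpha> \<and> \<alpha> \<le> 1 \<and> (SUP i. C1_Holder_norm \<alpha> (g i)) < \<infinity>) \<and>
     (\<forall>i. g i 0 = 0 \<and> g i 1 = 0) \<and>
     (\<forall>i. \<forall>s\<in>{0<..<1}. 0 < (INF j. ereal (g j s)) \<and> (INF j. ereal (g j s)) \<le> ereal (g i s) \<and>
        g i s \<le> deriv01 (g i) 0 * s) \<and>
     0 < Liminf (filtercomap abs at_top)
           (\<lambda>i. ereal (deriv01 (g i) 0 - (sqrt (d (i + 1)) - sqrt (d i))\<^sup>2))"

definition measure_preserving_Z_action :: "'a measure \<Rightarrow> (int \<Rightarrow> 'a \<Rightarrow> 'a) \<Rightarrow> bool" where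
  "measure_preserving_Z_action M \<pi> \<longleftrightarrow>
     (\<forall>i. \<pi> i \<in> measurable M M \<and> distr M M (\<pi> i) = M) \<and>
     (\<forall>\<omega>\<in>space M. \<pi> 0 \<omega> = \<omega>) \<and>
     (\<forall>i j. \<forall>\<omega>\<in>space M. \<pi> (i + j) \<omega> = \<pi> i (\<pi> j \<omega>))"

definition ergodic_action :: "'a measure \<Rightarrow> (int \<Rightarrow> 'a \<Rightarrow> 'a) \<Rightarrow> bool" where
  "ergodic_action M \<pi> \<longleftrightarrow>
     (\<forall>A\<in>sets M. (\<forall>i. \<pi> i -` A \<inter> space M = A) \<longrightarrow> measure M A = 0 \<or> measure M A = 1)"

text \<open>Elements of \<open>X\<^sub>n\<close> are represented by functions on all integers, of which only the
  values at \<open>i \<ge> n\<close> are used.\<close>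

definition L_op :: "(int \<Rightarrow> real) \<Rightarrow> (int \<Rightarrow> real) \<Rightarrow> (int \<Rightarrow> real) \<Rightarrow> int \<Rightarrow> real" where
  "L_op c d \<phi> i = d (i + 1) * (\<phi> (i + 1) - \<phi> i) + d i * (\<phi> (i - 1) - \<phi> i) + c i * \<phi> i"

definition Lp_op :: "(int \<Rightarrow> real) \<Rightarrow> (int \<Rightarrow> real) \<Rightarrow> real \<Rightarrow> (int \<Rightarrow> real) \<Rightarrow> int \<Rightarrow> real" where
  "Lp_op c d p \<phi> i = exp (- p * real_of_int i) * L_op c d (\<lambda>j. exp (p * real_of_int j) * \<phi> j) i"

definition test_functions :: "int \<Rightarrow> (int \<Rightarrow> real) set" where
  "test_functions n = {\<phi>.
     (\<forall>i\<ge>n. \<phi> i > 0) \<and>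
     ((\<lambda>i. ln (\<phi> i) / real_of_int i) \<longlongrightarrow> 0) at_top \<and>
     bounded ((\<lambda>i. (\<phi> (i + 1) - \<phi> i) / \<phi> i) ` {n..}) \<and>
     bounded ((\<lambda>i. (\<phi> (i + 1) - \<phi> i) / \<phi> (i + 1)) ` {n..})}"

definition lower_eigenvalue :: "(int \<Rightarrow> real) \<Rightarrow> (int \<Rightarrow> real) \<Rightarrow> real \<Rightarrow> int \<Rightarrow> ereal" where
  "lower_eigenvalue c d p n =
     Sup {ereal l | l. \<exists>\<phi>\<in>test_functions n. \<forall>i>n. Lp_op c d p \<phi> i \<ge> l * \<phi> i}"

definition upper_eigenvalue :: "(int \<Rightarrow> real) \<Rightarrow> (int \<Rightarrow> real) \<Rightarrow> real \<Rightarrow> int \<Rightarrow> ereal" where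
  "upper_eigenvalue c d p n =
     Inf {ereal l | l. \<exists>\<phi>\<in>test_functions n. \<forall>i>n. Lp_op c d p \<phi> i \<le> l * \<phi> i}"

definition H_lower :: "(int \<Rightarrow> real) \<Rightarrow> (int \<Rightarrow> real) \<Rightarrow> real \<Rightarrow> ereal" where
  "H_lower c d p = Lim at_top (lower_eigenvalue c d p)"

definition H_upper :: "(int \<Rightarrow> real) \<Rightarrow> (int \<Rightarrow> real) \<Rightarrow> real \<Rightarrow> ereal" where
  "H_upper c d p = Lim at_top (upper_eigenvalue c d p)"

text \<open>\<open>is_speed H w\<close> says that \<open>w\<close> is the minimum of \<open>H (- p) / p\<close> over \<open>p > 0\<close>; it determines
  \<open>w\<close> uniquely and asserts that the minimum is attained.\<close>

definition is_speed :: "(real \<Rightarrow> ereal) \<Rightarrow> real \<Rightarrow> bool" where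
  "is_speed H w \<longleftrightarrow>
     (\<exists>p>0. H (- p) / ereal p = ereal w) \<and> (\<forall>p>0. ereal w \<le> H (- p) / ereal p)"

end

theory Submission
  imports Defs
begin

text \<open>Write \<open>r i\<close> for the ratio \<open>\<psi> (i + 1) / \<psi> i\<close> of a positive function \<open>\<psi> = exp (p i) \<phi>\<close>. The
  eigenvalue inequality with level \<open>l\<close> becomes a Riccati inequality for \<open>r\<close>, and \<open>\<phi>\<close> is a test
  function if \<open>r\<close> and \<open>1 / r\<close> are bounded and the averages of \<open>ln r\<close> tend to \<open>p\<close>. Let \<open>\<Lambda>\<close> be the
  lowest level with supersolutions on all half-lines. For \<open>l \<ge> \<Lambda>\<close> the minimal supersolution is a
  stationary process, so by Birkhoff's theorem it has an almost sure rate \<open>- \<gamma> l\<close>; it solves the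
  eigenvalue equation, whence by the maximum principle both eigenvalues at \<open>- \<gamma> l\<close> equal \<open>l\<close>. For
  \<open>l < \<Lambda>\<close> the forward Riccati iteration started from a large value almost surely becomes small, after
  a time that is sublinear in the starting site; alternating such descents with large values gives
  subsolutions of every prescribed rate, so the lower eigenvalue is at least \<open>\<Lambda>\<close> everywhere. The function
  \<open>\<gamma>\<close> is deterministic, concave, continuous and grows at most logarithmically, hence \<open>\<gamma> l / l\<close> has
  a maximum over \<open>l \<ge> \<Lambda>\<close>, and the reciprocal of that maximum is both speeds.\<close>

section \<open>Birkhoff's theorem for bounded functions\<close>

text \<open>Why the minimal supersolution: its ratio at a site is an explicit limit of backward
  iterations from a zero ratio far to the right (a Dirichlet condition), so it depends measurably on
  the coefficients and commutes with the shift. An arbitrarily chosen supersolution need not do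
  either. Equality of the two eigenvalues is proved only at the rates \<open>- \<gamma> l\<close>.
  By continuity and unboundedness of \<open>\<gamma>\<close> these cover all \<open>- p\<close> with
  \<open>p \<ge> \<gamma> \<Lambda>\<close>. For \<open>0 < p < \<gamma> \<Lambda>\<close> only the
  lower bound \<open>\<Lambda>\<close> is shown. It suffices because a speed is a minimum and
  \<open>\<Lambda> / p\<close> exceeds \<open>\<Lambda> / \<gamma> \<Lambda>\<close> there.
  Positivity of \<open>\<Lambda>\<close>, which lets \<open>\<gamma> l / l\<close> be maximised down
  to the endpoint, comes from the lower limit condition tested on the constant function. The bounds
  on the coefficients depend on the event a priori; ergodicity replaces them by one deterministic
  constant.\<close>

locale ergodic_shift = prob_space M for M :: "'a measure" +
  fixes \<pi> :: "int \<Rightarrow> 'a \<Rightarrow> 'a"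
  assumes action: "measure_preserving_Z_action M \<pi>"
    and ergodic: "ergodic_action M \<pi>"
begin

lemma pi_measurable [measurable]: "\<pi> i \<in> measurable M M"
  using action by (simp add: measure_preserving_Z_action_def)

lemma pi_space [simp]: "\<omega> \<in> space M \<Longrightarrow> \<pi> i \<omega> \<in> space M"
  using pi_measurable by (rule measurable_space)

lemma pi_0 [simp]: "\<omega> \<in> space M \<Longrightarrow> \<pi> 0 \<omega> = \<omega>"
  using action by (simp add: measure_preserving_Z_action_def)

lemma pi_add: "\<omega> \<in> space M \<Longrightarrow> \<pi> i (\<pi> j \<omega>) = \<pi> (i + j) \<omega>"
  using action by (simp add: measure_preserving_Z_action_def)

lemma distr_pi: "distr M M (\<pi> i) = M"
  using action by (simp add: measure_preserving_Z_action_def)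

lemma AE_pi:
  assumes "AE \<omega> in M. P \<omega>"
  shows "AE \<omega> in M. \<forall>i. P (\<pi> i \<omega>)"
proof -
  have "AE \<omega> in M. P (\<pi> i \<omega>)" for i
    using AE_distrD[OF pi_measurable[of i], of P] assms unfolding distr_pi by blast
  then show ?thesis by (simp add: AE_all_countable)
qed

lemma expectation_pi:
  fixes g :: "'a \<Rightarrow> real"
  assumes "g \<in> borel_measurable M"
  shows "expectation (\<lambda>\<omega>. g (\<pi> i \<omega>)) = expectation g"
  using integral_distr[OF pi_measurable assms, of i] unfolding distr_pi by simp

text \<open>Invariance under the generator extends to nonnegative powers by iteration and to
  negative ones by starting from \<open>\<pi> i \<omega>\<close>.\<close>

lemma zero_one_invariant:
  assumes A: "A \<in> sets M" and inv: "\<And>\<omega>. \<omega> \<in> space M \<Longrightarrow> \<omega> \<in> A \<longleftrightarrow> \<pi> 1 \<omega> \<in> A"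
  shows "prob A = 0 \<or> prob A = 1"
proof -
  have nat: "\<omega> \<in> A \<longleftrightarrow> \<pi> (int n) \<omega> \<in> A" if "\<omega> \<in> space M" for n \<omega>
  proof (induction n)
    case (Suc n)
    then show ?case using inv[of "\<pi> (int n) \<omega>"] that by (simp add: pi_add)
  qed (use that in simp)
  have "\<omega> \<in> A \<longleftrightarrow> \<pi> i \<omega> \<in> A" if w: "\<omega> \<in> space M" for i \<omega>
  proof (cases "i \<ge> 0")
    case True
    then show ?thesis using nat[OF w, of "nat i"] by simp
  next
    case False
    then show ?thesis using nat[of "\<pi> i \<omega>" "nat (- i)"] w by (simp add: pi_add)
  qed
  then have "\<pi> i -` A \<inter> space M = A" for i
    using sets.sets_into_space[OF A] by auto
  with ergodic A show ?thesis by (auto simp: ergodic_action_def)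
qed

text \<open>The preimages of \<open>A\<close> under the forward shifts increase and all have the
  measure of \<open>A\<close>. Their union therefore has that measure too, and it is fully
  invariant.\<close>

lemma zero_one_forward_invariant:
  assumes A: "A \<in> sets M" and inv: "\<And>\<omega>. \<omega> \<in> A \<Longrightarrow> \<pi> 1 \<omega> \<in> A"
  shows "prob A = 0 \<or> prob A = 1"
proof -
  have sp: "\<omega> \<in> space M" if "\<omega> \<in> A" for \<omega> using sets.sets_into_space[OF A] that by auto
  define E where "E n = \<pi> (int n) -` A \<inter> space M" for n
  have Es: "range E \<subseteq> sets M" unfolding E_def using A by (auto intro: measurable_sets)
  have "E n \<subseteq> E (Suc n)" for n
    unfolding E_def using inv by (fastforce simp: pi_add)
  then have inc: "incseq E" by (rule incseq_SucI)
  have pE: "prob (E n) = prob A" for n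
    unfolding E_def using measure_distr[OF pi_measurable A, of "int n"] distr_pi by simp
  have "(\<lambda>n. prob (E n)) \<longlonglongrightarrow> prob (\<Union>n. E n)"
    by (rule finite_Lim_measure_incseq[OF Es inc])
  then have eq: "prob (\<Union>n. E n) = prob A"
    unfolding pE by (simp add: LIMSEQ_const_iff)
  have "\<omega> \<in> (\<Union>n. E n) \<longleftrightarrow> \<pi> 1 \<omega> \<in> (\<Union>n. E n)" if w: "\<omega> \<in> space M" for \<omega>
  proof
    assume "\<omega> \<in> (\<Union>n. E n)"
    then obtain n where "\<pi> (int n) \<omega> \<in> A" by (auto simp: E_def)
    then have "\<pi> 1 (\<pi> (int n) \<omega>) \<in> A" by (rule inv)
    then show "\<pi> 1 \<omega> \<in> (\<Union>n. E n)" using w by (auto simp: E_def pi_add add.commute)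
  next
    assume "\<pi> 1 \<omega> \<in> (\<Union>n. E n)"
    then obtain n where "\<pi> (int n) (\<pi> 1 \<omega>) \<in> A" by (auto simp: E_def)
    then have "\<pi> (int (Suc n)) \<omega> \<in> A" using w by (simp add: pi_add add.commute)
    then show "\<omega> \<in> (\<Union>n. E n)" using w unfolding E_def by blast
  qed
  then show ?thesis
    using zero_one_invariant[of "\<Union>n. E n"] Es eq by auto
qed

text \<open>The maxima \<open>\<Phi> n\<close> of the first \<open>n + 1\<close> partial sums satisfy \<open>\<Phi> (n + 1) = g + max 0 (\<Phi> n \<circ> \<pi> 1)\<close>. If the
  partial sums were unbounded almost surely, then \<open>\<Phi> (n + 1) - \<Phi> n \<circ> \<pi> 1\<close>, which has nonnegative mean,
  would tend to \<open>g\<close>.\<close>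

lemma birkhoff_bounded_above:
  fixes g :: "'a \<Rightarrow> real"
  assumes g [measurable]: "g \<in> borel_measurable M"
    and bd: "\<And>\<omega>. \<omega> \<in> space M \<Longrightarrow> \<bar>g \<omega>\<bar> \<le> C"
    and neg: "expectation g < 0"
  shows "AE \<omega> in M. \<exists>B. \<forall>n. (\<Sum>i<n. g (\<pi> (int i) \<omega>)) \<le> B"
proof -
  define S where "S n \<omega> = (\<Sum>i<n. g (\<pi> (int i) \<omega>))" for n \<omega>
  have S_meas [measurable]: "S n \<in> borel_measurable M" for n
    unfolding S_def by measurable
  have S_Suc: "S (Suc n) \<omega> = g \<omega> + S n (\<pi> 1 \<omega>)" if "\<omega> \<in> space M" for n \<omega>
    using that unfolding S_def by (simp add: sum.lessThan_Suc_shift pi_add add.commute del: sum.lessThan_Suc)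
  \<comment> \<open>Bounds range over the naturals so that the event is a countable combination of
    measurable ones; \<open>A_alt\<close> recovers all real bounds.\<close>
  define A where "A = {\<omega> \<in> space M. \<forall>B::nat. \<exists>n. S n \<omega> > real B}"
  have A_alt: "\<omega> \<in> A \<longleftrightarrow> \<omega> \<in> space M \<and> (\<forall>B. \<exists>n. S n \<omega> > B)" for \<omega>
    unfolding A_def by simp (meson less_le_trans less_trans reals_Archimedean2)
  have A_meas: "A \<in> sets M" unfolding A_def by measurable
  have A_inv: "\<omega> \<in> A \<longleftrightarrow> \<pi> 1 \<omega> \<in> A" if w: "\<omega> \<in> space M" for \<omega>
  proof
    assume a: "\<omega> \<in> A"
    have "\<exists>n. S n (\<pi> 1 \<omega>) > B" for B
    proof -
      obtain n where n: "S n \<omega> > max 0 (B + g \<omega>)" using a A_alt by blast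
      then obtain m where "n = Suc m" by (cases n) (auto simp: S_def)
      then show ?thesis using n S_Suc[OF w, of m] by (intro exI[of _ m]) auto
    qed
    then show "\<pi> 1 \<omega> \<in> A" using w by (simp add: A_alt)
  next
    assume a: "\<pi> 1 \<omega> \<in> A"
    have "\<exists>n. S n \<omega> > B" for B
    proof -
      obtain n where "S n (\<pi> 1 \<omega>) > B - g \<omega>" using a A_alt by blast
      then show ?thesis using S_Suc[OF w, of n] by (intro exI[of _ "Suc n"]) auto
    qed
    then show "\<omega> \<in> A" using w by (simp add: A_alt)
  qed
  have "prob A \<noteq> 1"
  proof
    assume pA: "prob A = 1"
    define \<Phi> where "\<Phi> = rec_nat g (\<lambda>n h \<omega>. g \<omega> + max 0 (h (\<pi> 1 \<omega>)))"
    have \<Phi>0: "\<Phi> 0 = g" and \<Phi>S: "\<Phi> (Suc n) \<omega> = g \<omega> + max 0 (\<Phi> n (\<pi> 1 \<omega>))" for n \<omega>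
      by (auto simp: \<Phi>_def)
    have \<Phi>m [measurable]: "\<Phi> n \<in> borel_measurable M" for n
    proof (induction n)
      case (Suc n)
      note Suc[measurable]
      show ?case unfolding \<Phi>S[abs_def] by measurable
    qed (simp add: \<Phi>0)
    have \<Phi>mono: "\<Phi> n \<omega> \<le> \<Phi> (Suc n) \<omega>" if "\<omega> \<in> space M" for n \<omega>
      using that
    proof (induction n arbitrary: \<omega>)
      case (Suc n)
      show ?case unfolding \<Phi>S[of "Suc n" \<omega>] \<Phi>S[of n \<omega>]
        using Suc.IH[of "\<pi> 1 \<omega>"] Suc.prems by (auto intro: max.mono)
    qed (simp add: \<Phi>0 \<Phi>S)
    have \<Phi>g: "g \<omega> \<le> \<Phi> n \<omega>" for n \<omega> by (cases n) (auto simp: \<Phi>0 \<Phi>S)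
    have \<Phi>b: "\<bar>\<Phi> n \<omega>\<bar> \<le> real (Suc n) * C" if "\<omega> \<in> space M" for n \<omega>
      using that
    proof (induction n arbitrary: \<omega>)
      case 0 then show ?case using bd by (simp add: \<Phi>0)
    next
      case (Suc n)
      have "\<bar>\<Phi> (Suc n) \<omega>\<bar> \<le> \<bar>g \<omega>\<bar> + \<bar>\<Phi> n (\<pi> 1 \<omega>)\<bar>"
        unfolding \<Phi>S by (simp add: max_def abs_if)
      also have "\<dots> \<le> C + real (Suc n) * C"
        using Suc.IH[of "\<pi> 1 \<omega>"] Suc.prems bd[of \<omega>] by (intro add_mono) auto
      finally show ?case by (simp add: algebra_simps)
    qed
    have \<Phi>ge: "S (Suc k) \<omega> \<le> \<Phi> n \<omega>" if "\<omega> \<in> space M" "k \<le> n" for n k \<omega>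
      using that
    proof (induction n arbitrary: k \<omega>)
      case 0 then show ?case by (simp add: \<Phi>0 S_def)
    next
      case (Suc n)
      show ?case
      proof (cases k)
        case 0
        then show ?thesis using Suc.prems by (simp add: \<Phi>S S_def)
      next
        case (Suc l)
        then show ?thesis
          using Suc.IH[of "\<pi> 1 \<omega>" l] Suc.prems S_Suc[of \<omega> k] by (simp add: \<Phi>S)
      qed
    qed
    define D where "D n \<omega> = \<Phi> (Suc n) \<omega> - \<Phi> n (\<pi> 1 \<omega>)" for n \<omega>
    have Deq: "D n \<omega> = g \<omega> + max (- \<Phi> n (\<pi> 1 \<omega>)) 0" for n \<omega>
      by (auto simp: D_def \<Phi>S max_def)
    have int\<Phi>: "integrable M (\<Phi> n)" for n
      by (rule integrable_const_bound[of _ "real (Suc n) * C"]) (use \<Phi>b in auto)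
    have int\<Phi>': "integrable M (\<lambda>\<omega>. \<Phi> n (\<pi> 1 \<omega>))" for n
      by (rule integrable_const_bound[of _ "real (Suc n) * C"]) (use \<Phi>b in auto)
    have D_nonneg: "expectation (D n) \<ge> 0" for n
    proof -
      have "expectation (D n) = expectation (\<Phi> (Suc n)) - expectation (\<Phi> n)"
        unfolding D_def using int\<Phi> int\<Phi>' expectation_pi[OF \<Phi>m, of n 1] by simp
      moreover have "expectation (\<Phi> n) \<le> expectation (\<Phi> (Suc n))"
        by (rule integral_mono[OF int\<Phi> int\<Phi>]) (use \<Phi>mono in auto)
      ultimately show ?thesis by simp
    qed
    have AEA: "AE \<omega> in M. \<omega> \<in> A" using AE_prob_1[OF pA] .
    have "(\<lambda>n. expectation (D n)) \<longlonglongrightarrow> expectation g"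
    \<comment> \<open>Since \<open>\<Phi> n \<ge> g \<ge> - C\<close>, the term added to
      \<open>g\<close> in \<open>Deq\<close> lies between \<open>0\<close> and
      \<open>C\<close>.\<close>
    proof (rule integral_dominated_convergence[where w="\<lambda>_. 2 * C"])
      show "D n \<in> borel_measurable M" for n unfolding D_def by measurable
      show "AE \<omega> in M. norm (D n \<omega>) \<le> 2 * C" for n
      proof (rule AE_I2)
        fix \<omega> assume "\<omega> \<in> space M"
        then show "norm (D n \<omega>) \<le> 2 * C"
          using bd[of \<omega>] bd[of "\<pi> 1 \<omega>"] \<Phi>g[of "\<pi> 1 \<omega>" n] unfolding Deq by (auto simp: max_def)
      qed
      show "AE \<omega> in M. (\<lambda>n. D n \<omega>) \<longlonglongrightarrow> g \<omega>"
        using AEA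
      proof eventually_elim
        case (elim \<omega>)
        then have w: "\<omega> \<in> space M" and "\<pi> 1 \<omega> \<in> A" using A_inv A_alt by auto
        then obtain n where n: "S n (\<pi> 1 \<omega>) > 0" using A_alt by blast
        then obtain k where k: "n = Suc k" by (cases n) (auto simp: S_def)
        have "D m \<omega> = g \<omega>" if "m \<ge> k" for m
          using \<Phi>ge[of "\<pi> 1 \<omega>" k m] w that n k by (simp add: Deq)
        then show ?case
          by (intro tendsto_eventually) (auto simp: eventually_at_top_linorder)
      qed
    qed (use g in auto)
    then have "expectation g \<ge> 0"
      by (rule LIMSEQ_le_const) (use D_nonneg in auto)
    then show False using neg by simp
  qed
  then have "prob A = 0" using zero_one_invariant[OF A_meas A_inv] by blast
  then have "AE \<omega> in M. \<omega> \<notin> A" using A_meas prob_eq_0 by blast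
  then show ?thesis
  proof (rule AE_mp, intro AE_I2 impI)
    fix \<omega> assume "\<omega> \<in> space M" "\<omega> \<notin> A"
    then show "\<exists>B. \<forall>n. (\<Sum>i<n. g (\<pi> (int i) \<omega>)) \<le> B"
      using A_alt[of \<omega>] unfolding S_def by (metis not_le)
  qed
qed

text \<open>The function \<open>g - expectation g - \<epsilon>\<close> has mean
  \<open>- \<epsilon>\<close>, so its partial sums stay below a random bound. A second
  \<open>\<epsilon>\<close> per site eventually absorbs that bound, whence the error
  \<open>2 / real (Suc k)\<close>.\<close>

lemma birkhoff_upper:
  fixes g :: "'a \<Rightarrow> real"
  assumes g [measurable]: "g \<in> borel_measurable M"
    and bd: "\<And>\<omega>. \<omega> \<in> space M \<Longrightarrow> \<bar>g \<omega>\<bar> \<le> C"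
  shows "AE \<omega> in M. \<forall>k. \<forall>\<^sub>F n in sequentially.
    (\<Sum>i<n. g (\<pi> (int i) \<omega>)) / real n < expectation g + 2 / real (Suc k)"
  unfolding AE_all_countable
proof
  fix k
  define \<epsilon> where "\<epsilon> = 1 / real (Suc k)"
  have e: "\<epsilon> > 0" by (simp add: \<epsilon>_def)
  define h where "h \<omega> = g \<omega> - expectation g - \<epsilon>" for \<omega>
  have [measurable]: "h \<in> borel_measurable M" unfolding h_def by measurable
  have int: "integrable M g"
    by (rule integrable_const_bound[of _ C]) (use bd in auto)
  have "expectation h = - \<epsilon>" unfolding h_def using int by (simp add: prob_space)
  moreover have "\<bar>h \<omega>\<bar> \<le> C + \<bar>expectation g\<bar> + \<epsilon>" if "\<omega> \<in> space M" for \<omega>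
    using bd[OF that] e unfolding h_def by linarith
  ultimately have "AE \<omega> in M. \<exists>B. \<forall>n. (\<Sum>i<n. h (\<pi> (int i) \<omega>)) \<le> B"
    using e by (intro birkhoff_bounded_above) auto
  then show "AE \<omega> in M. \<forall>\<^sub>F n in sequentially.
    (\<Sum>i<n. g (\<pi> (int i) \<omega>)) / real n < expectation g + 2 / real (Suc k)"
  proof eventually_elim
    case (elim \<omega>)
    then obtain B where B: "\<And>n. (\<Sum>i<n. h (\<pi> (int i) \<omega>)) \<le> B" by blast
    have "\<forall>\<^sub>F n in sequentially. real n > B / \<epsilon> \<and> n > 0"
      using filterlim_real_sequentially eventually_gt_at_top[of 0]
      by (auto simp: filterlim_at_top_dense eventually_conj_iff)
    then show ?case
    proof eventually_elim
      case (elim n)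
      have "(\<Sum>i<n. g (\<pi> (int i) \<omega>)) \<le> B + real n * (expectation g + \<epsilon>)"
        using B[of n] unfolding h_def by (simp add: sum_subtractf algebra_simps)
      moreover have "B < real n * \<epsilon>" using elim e by (simp add: field_simps)
      ultimately have "(\<Sum>i<n. g (\<pi> (int i) \<omega>)) < real n * (expectation g + 2 * \<epsilon>)"
        by (simp add: algebra_simps)
      then show ?case using elim by (simp add: \<epsilon>_def field_simps)
    qed
  qed
qed

theorem birkhoff:
  fixes g :: "'a \<Rightarrow> real"
  assumes g [measurable]: "g \<in> borel_measurable M"
    and bd: "\<And>\<omega>. \<omega> \<in> space M \<Longrightarrow> \<bar>g \<omega>\<bar> \<le> C"
  shows "AE \<omega> in M. (\<lambda>n. (\<Sum>i<n. g (\<pi> (int i) \<omega>)) / real n) \<longlonglongrightarrow> expectation g"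
proof -
  have up: "AE \<omega> in M. \<forall>k. \<forall>\<^sub>F n in sequentially.
    (\<Sum>i<n. g (\<pi> (int i) \<omega>)) / real n < expectation g + 2 / real (Suc k)"
    by (rule birkhoff_upper[OF g bd])
  have lo: "AE \<omega> in M. \<forall>k. \<forall>\<^sub>F n in sequentially.
    (\<Sum>i<n. - g (\<pi> (int i) \<omega>)) / real n < expectation (\<lambda>\<omega>. - g \<omega>) + 2 / real (Suc k)"
    by (rule birkhoff_upper[where C=C]) (use bd in auto)
  from up lo show ?thesis
  proof eventually_elim
    case (elim \<omega>)
    show ?case
    proof (rule LIMSEQ_I)
      fix r :: real assume "r > 0"
      then obtain k where "inverse (real (Suc k)) < r / 2"
        using reals_Archimedean[of "r / 2"] by auto
      then have k: "2 / real (Suc k) < r" by (simp add: field_simps)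
      have "\<forall>\<^sub>F n in sequentially. norm ((\<Sum>i<n. g (\<pi> (int i) \<omega>)) / real n - expectation g) < r"
        using elim(1)[rule_format, of k] elim(2)[rule_format, of k]
      proof eventually_elim
        case (elim n)
        then show ?case using k by (simp add: sum_negf)
      qed
      then show "\<exists>no. \<forall>n\<ge>no. norm ((\<Sum>i<n. g (\<pi> (int i) \<omega>)) / real n - expectation g) < r"
        by (simp add: eventually_sequentially)
    qed
  qed
qed

end

section \<open>Riccati inequalities and the minimal supersolution\<close>

locale coeffs =
  fixes c d :: "int \<Rightarrow> real" and K :: real
begin

text \<open>Dividing the eigenvalue equation at level \<open>l\<close> by \<open>\<psi> i\<close>
  gives \<open>d (i + 1) * r i + d i / r (i - 1) = v l i\<close>.\<close>

definition v :: "real \<Rightarrow> int \<Rightarrow> real" where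
  "v l i = l - c i + d i + d (i + 1)"

definition B :: "real \<Rightarrow> real" where "B l = K * (\<bar>l\<bar> + 3 * K)"

text \<open>\<open>r i\<close> stands for the ratio \<open>\<psi> (i + 1) / \<psi> i\<close> of a positive function \<open>\<psi>\<close>.\<close>

definition supersolution :: "real \<Rightarrow> int \<Rightarrow> (int \<Rightarrow> real) \<Rightarrow> bool" where
  "supersolution l n r \<longleftrightarrow> (\<forall>i\<ge>n. r i > 0) \<and> (\<forall>i>n. d (i + 1) * r i + d i / r (i - 1) \<le> v l i)"

definition has_supersolutions :: "real \<Rightarrow> bool" where "has_supersolutions l \<longleftrightarrow> (\<forall>m. \<exists>r. supersolution l m r)"

text \<open>The cap \<open>B l\<close> is never active when supersolutions exist.\<close>

fun backward_riccati :: "real \<Rightarrow> nat \<Rightarrow> int \<Rightarrow> real" where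
  "backward_riccati l 0 i = 0"
| "backward_riccati l (Suc n) i =
    d (i + 1) / max (d (i + 1) / B l) (v l (i + 1) - d (i + 2) * backward_riccati l n (i + 1))"

definition minimal_ratio :: "real \<Rightarrow> int \<Rightarrow> real" where
  "minimal_ratio l i = lim (\<lambda>n. backward_riccati l n i)"

definition riccati :: "real \<Rightarrow> int \<Rightarrow> real \<Rightarrow> real" where
  "riccati l i x = (v l i - d i / x) / d (i + 1)"

text \<open>Stopping at the small value \<open>1 / Q\<close> keeps the iteration a subsolution.\<close>

fun forward_riccati :: "real \<Rightarrow> real \<Rightarrow> int \<Rightarrow> nat \<Rightarrow> real" where
  "forward_riccati l Q a 0 = Q"
| "forward_riccati l Q a (Suc t) = max (1 / Q) (riccati l (a + int t + 1) (forward_riccati l Q a t))"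

end

lemma v_shift: "coeffs.v (\<lambda>i. c (i + j)) (\<lambda>i. d (i + j)) l i = coeffs.v c d l (i + j)"
  by (simp add: coeffs.v_def algebra_simps)

lemma backward_riccati_shift: "coeffs.backward_riccati (\<lambda>i. c (i + j)) (\<lambda>i. d (i + j)) K l n i = coeffs.backward_riccati c d K l n (i + j)"
  by (induction n arbitrary: i) (simp_all add: coeffs.backward_riccati.simps v_shift algebra_simps)

text \<open>Translation covariance of the construction; for random coefficients it becomes
  stationarity of the minimal ratios.\<close>

lemma minimal_ratio_shift: "coeffs.minimal_ratio (\<lambda>i. c (i + j)) (\<lambda>i. d (i + j)) K l i = coeffs.minimal_ratio c d K l (i + j)"
  by (simp add: coeffs.minimal_ratio_def backward_riccati_shift)

lemma forward_riccati_shift_coeffs: "coeffs.forward_riccati (\<lambda>i. c (i + j)) (\<lambda>i. d (i + j)) l Q a t = coeffs.forward_riccati c d l Q (a + j) t"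
  by (induction t) (simp_all add: coeffs.forward_riccati.simps coeffs.riccati_def v_shift algebra_simps)

locale bounded_coeffs = coeffs +
  assumes K1: "K \<ge> 1"
    and d_ge: "\<And>i. 1 / K \<le> d i" and d_le: "\<And>i. d i \<le> K"
    and c_abs: "\<And>i. \<bar>c i\<bar> \<le> K"
begin

lemma d_pos [simp]: "d i > 0"
  using d_ge[of i] K1 by (smt (verit) divide_pos_pos)

lemma d_neq_0 [simp]: "d i \<noteq> 0"
  using d_pos[of i] by linarith

lemma d_nonneg [simp]: "d i \<ge> 0"
  using d_pos[of i] by linarith

lemma v_le: "v l i \<le> l + 3 * K"
  using d_le[of i] d_le[of "i+1"] c_abs[of i] unfolding v_def by linarith

lemma B_ge_1: "B l \<ge> 1"
proof -
  have "1 * 1 \<le> K * (\<bar>l\<bar> + 3 * K)" using K1 by (intro mult_mono) auto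
  then show ?thesis by (simp add: B_def)
qed

lemma B_pos [simp]: "B l > 0"
  using B_ge_1[of l] by linarith

lemma B_neq_0 [simp]: "B l \<noteq> 0"
  using B_pos[of l] by linarith

lemma B_nonneg [simp]: "B l \<ge> 0"
  using B_ge_1[of l] by linarith

lemma v_div_le_B: "v l i / d j \<le> B l"
proof -
  have "v l i \<le> \<bar>l\<bar> + 3 * K" using v_le[of l i] by linarith
  also have "\<dots> = B l * (1 / K)" using K1 by (simp add: B_def)
  also have "\<dots> \<le> B l * d j" using d_ge[of j] B_pos[of l] by (intro mult_left_mono) auto
  finally show ?thesis by (simp add: pos_divide_le_eq)
qed

lemma supersolution_upper: assumes "supersolution l n r" "i > n" shows "r i \<le> B l"
proof -
  have "r (i - 1) > 0" "d (i + 1) * r i + d i / r (i - 1) \<le> v l i"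
    using assms by (auto simp: supersolution_def)
  moreover have "d i / r (i - 1) > 0" using calculation by simp
  ultimately have "d (i + 1) * r i \<le> v l i" by linarith
  then have "r i \<le> v l i / d (i + 1)" by (simp add: pos_le_divide_eq mult.commute)
  then show ?thesis using v_div_le_B[of l i "i+1"] by linarith
qed

lemma supersolution_mono: "supersolution l n r \<Longrightarrow> l \<le> l' \<Longrightarrow> supersolution l' n r"
  unfolding supersolution_def v_def by fastforce

lemma cap_pos: "max (d i / B l) x > 0"
  by (simp add: less_max_iff_disj)

lemma cap_mono: "x \<le> y \<Longrightarrow> d i / max (d i / B l) y \<le> d i / max (d i / B l) x"
  using cap_pos[of i l x] by (intro divide_left_mono) (auto simp: mult_pos_pos cap_pos)

lemma backward_riccati_nonneg: "backward_riccati l n i \<ge> 0"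
  by (cases n) (auto simp: less_imp_le cap_pos)

lemma backward_riccati_le_B: "backward_riccati l n i \<le> B l"
proof (cases n)
  case (Suc m)
  have "d (i + 1) / max (d (i + 1) / B l) x \<le> d (i + 1) / (d (i + 1) / B l)" for x
    using cap_pos[of "i+1" l x] by (intro divide_left_mono) (auto simp: mult_pos_pos)
  then show ?thesis using Suc by simp
qed (simp add: less_imp_le)

text \<open>One backward step is nondecreasing in the ratio to its right, and the iteration starts
  from the least value \<open>0\<close>.\<close>

lemma backward_riccati_mono: "backward_riccati l n i \<le> backward_riccati l (Suc n) i"
proof (induction n arbitrary: i)
  case 0
  show ?case by (simp add: less_imp_le cap_pos)
next
  case (Suc n)
  show ?case unfolding backward_riccati.simps(2)[of l "Suc n" i] backward_riccati.simps(2)[of l n i]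
    by (intro cap_mono diff_left_mono mult_left_mono Suc d_nonneg)
qed

text \<open>The cap can only enlarge the denominator, hence lower the iterate, so the uncapped
  inequality of the supersolution suffices for the induction.\<close>

lemma backward_riccati_le_super: "supersolution l m r \<Longrightarrow> i \<ge> m \<Longrightarrow> backward_riccati l n i \<le> r i"
proof (induction n arbitrary: i)
  case 0
  then show ?case by (auto simp: supersolution_def less_imp_le)
next
  case (Suc n)
  then have IH: "backward_riccati l n (i + 1) \<le> r (i + 1)" by auto
  have r: "r i > 0" "d (i + 2) * r (i + 1) + d (i + 1) / r i \<le> v l (i + 1)"
    using Suc.prems unfolding supersolution_def by (auto dest: spec[of _ "i + 1"] simp: add.assoc)
  have "d (i + 2) * backward_riccati l n (i + 1) \<le> d (i + 2) * r (i + 1)"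
    using IH by (simp add: less_imp_le)
  then have "d (i + 1) / r i \<le> max (d (i + 1) / B l) (v l (i + 1) - d (i + 2) * backward_riccati l n (i + 1))"
    using r(2) unfolding le_max_iff_disj by linarith
  then have "d (i + 1) / max (d (i + 1) / B l) (v l (i + 1) - d (i + 2) * backward_riccati l n (i + 1))
      \<le> d (i + 1) / (d (i + 1) / r i)"
    using r(1) cap_pos by (intro divide_left_mono) auto
  then show ?case using r(1) by simp
qed

lemma backward_riccati_tendsto: "(\<lambda>n. backward_riccati l n i) \<longlonglongrightarrow> minimal_ratio l i"
proof -
  have "Bseq (\<lambda>n. backward_riccati l n i)"
    using backward_riccati_nonneg backward_riccati_le_B by (intro BseqI'[of _ "B l"]) auto
  moreover have "incseq (\<lambda>n. backward_riccati l n i)" using backward_riccati_mono by (intro incseq_SucI)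
  ultimately have "convergent (\<lambda>n. backward_riccati l n i)"
    by (intro Bseq_monoseq_convergent) (auto simp: monoseq_iff)
  then show ?thesis unfolding minimal_ratio_def by (simp add: convergent_LIMSEQ_iff)
qed

lemma minimal_ratio_le_B: "minimal_ratio l i \<le> B l"
  using backward_riccati_tendsto by (rule LIMSEQ_le_const2) (use backward_riccati_le_B in auto)

lemma minimal_ratio_rec: "minimal_ratio l i =
    d (i + 1) / max (d (i + 1) / B l) (v l (i + 1) - d (i + 2) * minimal_ratio l (i + 1))"
proof -
  have "(\<lambda>n. backward_riccati l (Suc n) i) \<longlonglongrightarrow>
     d (i + 1) / max (d (i + 1) / B l) (v l (i + 1) - d (i + 2) * minimal_ratio l (i + 1))"
    unfolding backward_riccati.simps
    by (intro tendsto_intros backward_riccati_tendsto less_imp_neq[OF cap_pos, symmetric])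
  then show ?thesis using LIMSEQ_Suc[OF backward_riccati_tendsto, of l i] LIMSEQ_unique by blast
qed

lemma minimal_ratio_pos: "minimal_ratio l i > 0"
  by (subst minimal_ratio_rec) (simp add: cap_pos)

lemma minimal_ratio_le_super: "supersolution l m r \<Longrightarrow> i \<ge> m \<Longrightarrow> minimal_ratio l i \<le> r i"
  using backward_riccati_tendsto by (rule LIMSEQ_le_const2) (use backward_riccati_le_super in auto)

lemma has_supersolutions_mono: "has_supersolutions l \<Longrightarrow> l \<le> l' \<Longrightarrow> has_supersolutions l'"
  unfolding has_supersolutions_def using supersolution_mono by blast

lemma minimal_ratio_eq:
  assumes "has_supersolutions l"
  shows "d (i + 1) * minimal_ratio l i + d i / minimal_ratio l (i - 1) = v l i"
proof -
  \<comment> \<open>The margin of two sites is needed because \<open>supersolution_upper\<close>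
    bounds ratios only strictly to the right of the starting site, and the bound is used at
    \<open>i - 1\<close> to see that the cap is inactive.\<close>
  obtain r where r: "supersolution l (i - 2) r" using assms by (auto simp: has_supersolutions_def)
  have ri: "r (i - 1) > 0" "r (i - 1) \<le> B l" "d (i + 1) * r i + d i / r (i - 1) \<le> v l i"
    using r supersolution_upper[OF r, of "i - 1"] by (auto simp: supersolution_def)
  have "d (i + 1) * minimal_ratio l i \<le> d (i + 1) * r i"
    using minimal_ratio_le_super[OF r, of i] by (simp add: less_imp_le)
  then have a: "v l i - d (i + 1) * minimal_ratio l i \<ge> d i / r (i - 1)" using ri by linarith
  have "d i / r (i - 1) \<ge> d i / B l" using ri by (intro divide_left_mono) (auto simp: less_imp_le)
  then have "max (d i / B l) (v l i - d (i + 1) * minimal_ratio l i) = v l i - d (i + 1) * minimal_ratio l i"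
    using a by simp
  then have "minimal_ratio l (i - 1) = d i / (v l i - d (i + 1) * minimal_ratio l i)"
    using minimal_ratio_rec[of l "i - 1"] by (simp add: algebra_simps)
  moreover have "v l i - d (i + 1) * minimal_ratio l i > 0"
    using a ri(1) by (smt (verit) d_pos divide_pos_pos)
  ultimately show ?thesis by simp
qed

lemma minimal_ratio_super: "has_supersolutions l \<Longrightarrow> supersolution l m (minimal_ratio l)"
  unfolding supersolution_def using minimal_ratio_pos minimal_ratio_eq by auto

text \<open>The capped recursion yields this at every level, with or without supersolutions, so the
  logarithms of the minimal ratios are always bounded and integrable.\<close>

lemma minimal_ratio_ge: "minimal_ratio l i \<ge> 1 / B l"
proof -
  let ?m = "max (d (i + 1) / B l) (v l (i + 1) - d (i + 2) * minimal_ratio l (i + 1))"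
  have "d (i + 1) / B l \<le> d (i + 1) / 1" using B_ge_1[of l] by (intro divide_left_mono) auto
  moreover have "d (i + 1) * 1 \<le> d (i + 1) * B l" using B_ge_1[of l] by (intro mult_left_mono) auto
  moreover have "v l (i + 1) \<le> d (i + 1) * B l"
    using v_div_le_B[of l "i + 1" "i + 1"] by (simp add: pos_divide_le_eq mult.commute)
  moreover have "0 \<le> d (i + 2) * minimal_ratio l (i + 1)" using minimal_ratio_pos[of l "i + 1"] by simp
  ultimately have "?m \<le> d (i + 1) * B l" by (intro max.boundedI) linarith+
  then have "d (i + 1) / (d (i + 1) * B l) \<le> d (i + 1) / ?m"
    using cap_pos by (intro divide_left_mono) auto
  then show ?thesis using minimal_ratio_rec[of l i] by simp
qed

lemma minimal_ratio_antimono: "has_supersolutions l \<Longrightarrow> l \<le> l' \<Longrightarrow> minimal_ratio l' i \<le> minimal_ratio l i"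
  using minimal_ratio_le_super[OF supersolution_mono[OF minimal_ratio_super[of l i]], of l' i] by simp

lemma abs_ln_rmin_le: "\<bar>ln (minimal_ratio l i)\<bar> \<le> ln (B l)"
proof -
  have "ln (1 / B l) \<le> ln (minimal_ratio l i)" using minimal_ratio_ge[of l i] minimal_ratio_pos[of l i] by (subst ln_le_cancel_iff) auto
  moreover have "ln (minimal_ratio l i) \<le> ln (B l)" using minimal_ratio_le_B minimal_ratio_pos by (subst ln_le_cancel_iff) auto
  ultimately show ?thesis using B_pos[of l] by (simp add: ln_div)
qed

text \<open>The weighted geometric mean of two minimal ratios is a supersolution at the mean level:
  convexity of \<open>exp\<close> bounds both it and its reciprocal by arithmetic means, and
  \<open>v\<close> is affine in the level. Minimality then makes \<open>ln\<close> of the ratio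
  convex in the level, which is concavity of the decay rate.\<close>

lemma ln_rmin_concave:
  assumes "has_supersolutions l" "has_supersolutions l'" and t: "0 \<le> t" "t \<le> 1"
  shows "ln (minimal_ratio ((1 - t) * l + t * l') i) \<le> (1 - t) * ln (minimal_ratio l i) + t * ln (minimal_ratio l' i)"
proof -
  let ?l = "(1 - t) * l + t * l'"
  define r where "r i = exp ((1 - t) * ln (minimal_ratio l i) + t * ln (minimal_ratio l' i))" for i
  have cv: "convex_on UNIV exp" using exp_convex by blast
  have r1: "r j \<le> (1 - t) * minimal_ratio l j + t * minimal_ratio l' j" for j
    using convex_onD[OF cv t, of "ln (minimal_ratio l j)" "ln (minimal_ratio l' j)"] minimal_ratio_pos[of l j] minimal_ratio_pos[of l' j]
    by (simp add: r_def)
  have r2: "1 / r j \<le> (1 - t) * (1 / minimal_ratio l j) + t * (1 / minimal_ratio l' j)" for j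
  proof -
    have "1 / r j = exp ((1 - t) *\<^sub>R (- ln (minimal_ratio l j)) + t *\<^sub>R (- ln (minimal_ratio l' j)))"
      by (simp add: r_def inverse_eq_divide[symmetric] exp_minus[symmetric])
    also have "\<dots> \<le> (1 - t) * exp (- ln (minimal_ratio l j)) + t * exp (- ln (minimal_ratio l' j))"
      by (rule convex_onD[OF cv t]) auto
    finally show ?thesis using minimal_ratio_pos[of l j] minimal_ratio_pos[of l' j]
      by (simp add: exp_minus inverse_eq_divide)
  qed
  have "d (j + 1) * r j + d j / r (j - 1) \<le> v ?l j" for j
  proof -
    have "d (j + 1) * r j \<le> d (j + 1) * ((1 - t) * minimal_ratio l j + t * minimal_ratio l' j)"
      using r1 by (simp add: less_imp_le)
    moreover have "d j * (1 / r (j - 1)) \<le> d j * ((1 - t) * (1 / minimal_ratio l (j-1)) + t * (1 / minimal_ratio l' (j-1)))"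
      using r2[of "j-1"] by (intro mult_left_mono) (auto simp: less_imp_le)
    ultimately have "d (j + 1) * r j + d j / r (j - 1) \<le>
        (1 - t) * (d (j + 1) * minimal_ratio l j + d j / minimal_ratio l (j - 1)) + t * (d (j + 1) * minimal_ratio l' j + d j / minimal_ratio l' (j - 1))"
      by (simp add: algebra_simps)
    also have "\<dots> = (1 - t) * v l j + t * v l' j" using minimal_ratio_eq assms by simp
    also have "\<dots> = v ?l j" by (simp add: v_def algebra_simps)
    finally show ?thesis .
  qed
  then have "supersolution ?l i r" by (simp add: supersolution_def r_def)
  then have "minimal_ratio ?l i \<le> r i" by (rule minimal_ratio_le_super) simp
  then have "ln (minimal_ratio ?l i) \<le> ln (r i)" using minimal_ratio_pos[of ?l i] by (subst ln_le_cancel_iff) (auto simp: r_def)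
  then show ?thesis by (simp add: r_def)
qed

text \<open>A constant ratio is a supersolution once the level beats the worst coefficients, as
  \<open>v l j \<ge> l - K\<close>. High levels thus admit arbitrarily fast decay.\<close>

lemma minimal_ratio_le_const:
  assumes "0 < \<rho>" "K * \<rho> + K / \<rho> \<le> l - K"
  shows "has_supersolutions l" "minimal_ratio l i \<le> \<rho>"
proof -
  have "d (j + 1) * \<rho> + d j / \<rho> \<le> v l j" for j
  proof -
    have "d (j + 1) * \<rho> \<le> K * \<rho>" "d j / \<rho> \<le> K / \<rho>"
      using assms d_le by (auto intro!: mult_right_mono divide_right_mono)
    moreover have "l - K \<le> v l j" using c_abs[of j] d_pos[of j] d_pos[of "j+1"] unfolding v_def by linarith
    ultimately show ?thesis using assms by linarith
  qed
  then have s: "supersolution l m (\<lambda>_. \<rho>)" for m using assms by (simp add: supersolution_def)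
  then show "has_supersolutions l" by (auto simp: has_supersolutions_def)
  show "minimal_ratio l i \<le> \<rho>" by (rule minimal_ratio_le_super[OF s order_refl])
qed

text \<open>Minimal ratios increase as the level decreases, so they converge. The limit solves the
  equation at \<open>l\<close>, and minimality squeezes it onto the minimal ratio there.\<close>

lemma has_supersolutions_right_limit:
  assumes has_supersolutions: "\<And>n. has_supersolutions (l + 1 / real (Suc n))"
  shows "has_supersolutions l" "(\<lambda>n. minimal_ratio (l + 1 / real (Suc n)) i) \<longlonglongrightarrow> minimal_ratio l i"
proof -
  define e where "e n = 1 / real (Suc n)" for n
  have e0: "e \<longlonglongrightarrow> 0" unfolding e_def using LIMSEQ_inverse_real_of_nat by (simp add: inverse_eq_divide)
  have edec: "e (Suc n) \<le> e n" for n unfolding e_def by (simp add: field_simps)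
  have has_supersolutions': "has_supersolutions (l + e n)" for n using has_supersolutions by (simp add: e_def)
  define R where "R j = lim (\<lambda>n. minimal_ratio (l + e n) j)" for j
  have R: "(\<lambda>n. minimal_ratio (l + e n) j) \<longlonglongrightarrow> R j" for j
  proof -
    have "incseq (\<lambda>n. minimal_ratio (l + e n) j)"
      using minimal_ratio_antimono[OF has_supersolutions'] edec by (intro incseq_SucI) auto
    moreover have "minimal_ratio (l + e n) j \<le> B (\<bar>l\<bar> + 1)" for n
    proof -
      have "0 \<le> e n" "e n \<le> 1" unfolding e_def by (auto simp: field_simps)
      then have "\<bar>l + e n\<bar> \<le> \<bar>\<bar>l\<bar> + 1\<bar>" by linarith
      then have "B (l + e n) \<le> B (\<bar>l\<bar> + 1)" unfolding B_def using K1 by (intro mult_left_mono) auto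
      then show ?thesis using minimal_ratio_le_B[of "l + e n" j] by linarith
    qed
    then have "Bseq (\<lambda>n. minimal_ratio (l + e n) j)"
      using minimal_ratio_pos less_imp_le by (intro BseqI'[of _ "B (\<bar>l\<bar> + 1)"]) (auto simp: abs_of_pos)
    ultimately have "convergent (\<lambda>n. minimal_ratio (l + e n) j)"
      by (intro Bseq_monoseq_convergent) (auto simp: monoseq_iff)
    then show ?thesis unfolding R_def by (simp add: convergent_LIMSEQ_iff)
  qed
  have inc: "minimal_ratio (l + e n) j \<le> R j" for n j
    using minimal_ratio_antimono[OF has_supersolutions'] edec by (intro incseq_le[OF _ R] incseq_SucI) auto
  have Rpos: "R j > 0" for j using inc[of 0 j] minimal_ratio_pos[of "l + e 0" j] by linarith
  have "d (j + 1) * R j + d j / R (j - 1) = v l j" for j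
  proof (rule LIMSEQ_unique)
    show "(\<lambda>n. d (j + 1) * minimal_ratio (l + e n) j + d j / minimal_ratio (l + e n) (j - 1))
        \<longlonglongrightarrow> d (j + 1) * R j + d j / R (j - 1)"
      using Rpos[of "j - 1"] by (intro tendsto_intros R) auto
    have "(\<lambda>n. v (l + e n) j) \<longlonglongrightarrow> (l + 0) - c j + d j + d (j + 1)"
      unfolding v_def by (intro tendsto_intros e0)
    then show "(\<lambda>n. d (j + 1) * minimal_ratio (l + e n) j + d j / minimal_ratio (l + e n) (j - 1)) \<longlonglongrightarrow> v l j"
      using minimal_ratio_eq[OF has_supersolutions'] by (simp add: v_def)
  qed
  then have s: "supersolution l m R" for m by (simp add: supersolution_def Rpos)
  then show a: "has_supersolutions l" by (auto simp: has_supersolutions_def)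
  have "R i \<le> minimal_ratio l i"
    using R by (rule LIMSEQ_le_const2) (use minimal_ratio_antimono[OF a] in \<open>auto simp: e_def\<close>)
  moreover have "minimal_ratio l i \<le> R i" by (rule minimal_ratio_le_super[OF s order_refl])
  ultimately have "R i = minimal_ratio l i" by simp
  then show "(\<lambda>n. minimal_ratio (l + 1 / real (Suc n)) i) \<longlonglongrightarrow> minimal_ratio l i"
    using R[of i] by (simp add: e_def)
qed

end

section \<open>Eigenvalues and the maximum principle\<close>

lemma Lp_op_eq:
  "Lp_op c d p \<phi> i =
    d (i + 1) * exp p * \<phi> (i + 1) + d i * exp (- p) * \<phi> (i - 1) + (c i - d i - d (i + 1)) * \<phi> i"
proof -
  have 1: "exp (p * real_of_int (i + 1)) = exp (p * real_of_int i) * exp p"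
    "exp (p * real_of_int (i - 1)) = exp (p * real_of_int i) * exp (- p)"
    by (simp_all add: exp_add[symmetric] algebra_simps)
  have 2: "exp (- p * real_of_int i) = 1 / exp (p * real_of_int i)"
    by (simp add: exp_minus inverse_eq_divide)
  show ?thesis unfolding Lp_op_def L_op_def 1 2 by (simp add: field_simps)
qed

lemma test_functions_mono: "n \<le> m \<Longrightarrow> test_functions n \<subseteq> test_functions m"
proof
  fix \<phi> assume n: "n \<le> m" and \<phi>: "\<phi> \<in> test_functions n"
  have "{m..} \<subseteq> {n..}" using n by auto
  then have "bounded (f ` {n..}) \<Longrightarrow> bounded (f ` {m..})" for f :: "int \<Rightarrow> real"
    by (meson bounded_subset image_mono)
  then show "\<phi> \<in> test_functions m" using \<phi> n unfolding test_functions_def by simp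
qed

lemma lower_eigenvalue_mono:
  assumes "n \<le> m" shows "lower_eigenvalue c d p n \<le> lower_eigenvalue c d p m"
  unfolding lower_eigenvalue_def
proof (rule Sup_subset_mono, rule subsetI, clarify)
  fix l \<phi> assume "\<phi> \<in> test_functions n" "\<forall>i>n. l * \<phi> i \<le> Lp_op c d p \<phi> i"
  then have "\<phi> \<in> test_functions m" "\<forall>i>m. l * \<phi> i \<le> Lp_op c d p \<phi> i"
    using test_functions_mono[OF assms] assms by auto
  then show "\<exists>l'. ereal l = ereal l' \<and> (\<exists>\<phi>\<in>test_functions m. \<forall>i>m. l' * \<phi> i \<le> Lp_op c d p \<phi> i)"
    by blast
qed

lemma upper_eigenvalue_antimono:
  assumes "n \<le> m" shows "upper_eigenvalue c d p m \<le> upper_eigenvalue c d p n"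
  unfolding upper_eigenvalue_def
proof (rule Inf_superset_mono, rule subsetI, clarify)
  fix l \<phi> assume "\<phi> \<in> test_functions n" "\<forall>i>n. Lp_op c d p \<phi> i \<le> l * \<phi> i"
  then have "\<phi> \<in> test_functions m" "\<forall>i>m. Lp_op c d p \<phi> i \<le> l * \<phi> i"
    using test_functions_mono[OF assms] assms by auto
  then show "\<exists>l'. ereal l = ereal l' \<and> (\<exists>\<phi>\<in>test_functions m. \<forall>i>m. Lp_op c d p \<phi> i \<le> l' * \<phi> i)"
    by blast
qed

text \<open>Monotonicity in \<open>n\<close> makes the \<open>Lim\<close> of the definition a
  genuine limit in the extended reals.\<close>

lemma H_lower_SUP: "H_lower c d p = (SUP n. lower_eigenvalue c d p n)"
  unfolding H_lower_def
proof (rule tendsto_Lim)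
  show "(lower_eigenvalue c d p \<longlongrightarrow> (SUP n. lower_eigenvalue c d p n)) at_top"
  proof (rule order_tendstoI)
    fix a assume "a < (SUP n. lower_eigenvalue c d p n)"
    then obtain n where "a < lower_eigenvalue c d p n" by (auto simp: less_SUP_iff)
    then show "\<forall>\<^sub>F m in at_top. a < lower_eigenvalue c d p m"
      using lower_eigenvalue_mono[of n _ c d p] less_le_trans
      by (intro eventually_at_top_linorderI[of n]) blast
  next
    fix a assume "(SUP n. lower_eigenvalue c d p n) < a"
    then show "\<forall>\<^sub>F m in at_top. lower_eigenvalue c d p m < a"
      by (intro always_eventually allI) (meson SUP_upper UNIV_I le_less_trans)
  qed
qed simp

lemma H_upper_INF: "H_upper c d p = (INF n. upper_eigenvalue c d p n)"
  unfolding H_upper_def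
proof (rule tendsto_Lim)
  show "(upper_eigenvalue c d p \<longlongrightarrow> (INF n. upper_eigenvalue c d p n)) at_top"
  proof (rule order_tendstoI)
    fix a assume "(INF n. upper_eigenvalue c d p n) < a"
    then obtain n where "upper_eigenvalue c d p n < a" by (auto simp: INF_less_iff)
    then show "\<forall>\<^sub>F m in at_top. upper_eigenvalue c d p m < a"
      using upper_eigenvalue_antimono[of n _ c d p] le_less_trans
      by (intro eventually_at_top_linorderI[of n]) blast
  next
    fix a assume "a < (INF n. upper_eigenvalue c d p n)"
    then show "\<forall>\<^sub>F m in at_top. a < upper_eigenvalue c d p m"
      by (intro always_eventually allI) (meson INF_lower UNIV_I less_le_trans)
  qed
qed simp

lemma H_lower_ge:
  assumes "\<phi> \<in> test_functions n" "\<And>i. i > n \<Longrightarrow> Lp_op c d p \<phi> i \<ge> l * \<phi> i"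
  shows "ereal l \<le> H_lower c d p"
proof -
  have "ereal l \<le> lower_eigenvalue c d p n"
    unfolding lower_eigenvalue_def by (rule Sup_upper) (use assms in blast)
  also have "\<dots> \<le> H_lower c d p" unfolding H_lower_SUP by (rule SUP_upper) simp
  finally show ?thesis .
qed

lemma H_upper_le:
  assumes "\<phi> \<in> test_functions n" "\<And>i. i > n \<Longrightarrow> Lp_op c d p \<phi> i \<le> l * \<phi> i"
  shows "H_upper c d p \<le> ereal l"
proof -
  have "H_upper c d p \<le> upper_eigenvalue c d p n" unfolding H_upper_INF by (rule INF_lower) simp
  also have "\<dots> \<le> ereal l"
    unfolding upper_eigenvalue_def by (rule Inf_lower) (use assms in blast)
  finally show ?thesis .
qed

text \<open>The two bounds on relative increments amount to a two-sided bound on consecutive ratios,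
  which in the maximum principle controls neighbours by the value at the maximum.\<close>

lemma test_functions_ratio_bounded:
  assumes "\<phi> \<in> test_functions n"
  obtains Q where "Q > 0" "\<And>i. i \<ge> n \<Longrightarrow> \<phi> (i + 1) \<le> Q * \<phi> i" "\<And>i. i \<ge> n \<Longrightarrow> \<phi> i \<le> Q * \<phi> (i + 1)"
proof -
  have pos: "\<phi> i > 0" if "i \<ge> n" for i using assms that by (simp add: test_functions_def)
  obtain b1 where b1: "\<And>i. i \<ge> n \<Longrightarrow> \<bar>(\<phi> (i + 1) - \<phi> i) / \<phi> i\<bar> \<le> b1"
    using assms by (auto simp: test_functions_def bounded_iff)
  obtain b2 where b2: "\<And>i. i \<ge> n \<Longrightarrow> \<bar>(\<phi> (i + 1) - \<phi> i) / \<phi> (i + 1)\<bar> \<le> b2"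
    using assms by (auto simp: test_functions_def bounded_iff)
  define Q where "Q = 1 + \<bar>b1\<bar> + \<bar>b2\<bar>"
  show ?thesis
  proof
    show "Q > 0" by (simp add: Q_def)
    fix i assume i: "i \<ge> n"
    then have p: "\<phi> i > 0" "\<phi> (i + 1) > 0" using pos by auto
    have "(\<phi> (i + 1) - \<phi> i) / \<phi> i \<le> Q - 1" using b1[OF i] unfolding Q_def by linarith
    then show "\<phi> (i + 1) \<le> Q * \<phi> i" using p by (simp add: field_simps)
    have "(\<phi> (i + 1) - \<phi> i) / \<phi> (i + 1) \<ge> 1 - Q" using b2[OF i] unfolding Q_def by linarith
    then show "\<phi> i \<le> Q * \<phi> (i + 1)" using p by (simp add: field_simps)
  qed
qed

context bounded_coeffs
begin

text \<open>The ratio of the two test functions grows subexponentially, so after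
  multiplication with a flat tent \<open>exp (- \<delta> * \<bar>i - m\<bar>)\<close> it has an interior maximum.\<close>

lemma sub_le_super:
  assumes \<phi>: "\<phi> \<in> test_functions n" and sub: "\<And>i. i > n \<Longrightarrow> Lp_op c d p \<phi> i \<ge> l * \<phi> i"
    and \<psi>: "\<psi> \<in> test_functions n" and sup: "\<And>i. i > n \<Longrightarrow> Lp_op c d p \<psi> i \<le> u * \<psi> i"
  shows "l \<le> u"
proof (rule ccontr)
  assume "\<not> l \<le> u"
  then have ul: "u < l" by simp
  have pos: "\<phi> i > 0" "\<psi> i > 0" if "i \<ge> n" for i
    using \<phi> \<psi> that by (auto simp: test_functions_def)
  obtain Q where Q: "Q > 0" "\<And>i. i \<ge> n \<Longrightarrow> \<phi> (i + 1) \<le> Q * \<phi> i" "\<And>i. i \<ge> n \<Longrightarrow> \<phi> i \<le> Q * \<phi> (i + 1)"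
    using test_functions_ratio_bounded[OF \<phi>] by blast
  \<comment> \<open>\<open>C * \<phi> k\<close> bounds the off-diagonal part of
    \<open>Lp_op c d p \<phi> k\<close>. The slope \<open>\<delta>\<close> is then chosen so that
    the error caused by the tent, \<open>\<delta> * C\<close>, is smaller than the gap
    \<open>l - u\<close>.\<close>
  define C where "C = K * exp p * Q + K * exp (- p) * Q"
  have C: "C > 0" unfolding C_def using Q(1) K1 by (simp add: add_pos_pos)
  define \<delta> where "\<delta> = (l - u) / (2 * C)"
  have \<delta>: "\<delta> > 0" "\<delta> * C < l - u" using ul C by (auto simp: \<delta>_def)
  define z where "z i = ln (\<phi> i) - ln (\<psi> i)" for i
  have z0: "((\<lambda>i. z i / real_of_int i) \<longlongrightarrow> 0) at_top"
    using tendsto_diff[of "\<lambda>i. ln (\<phi> i) / real_of_int i" 0 at_top "\<lambda>i. ln (\<psi> i) / real_of_int i" 0] \<phi> \<psi>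
    by (simp add: test_functions_def z_def diff_divide_distrib)
  have "\<forall>\<^sub>F i in at_top. \<bar>z i / real_of_int i\<bar> < \<delta> / 2"
    using tendstoD[OF z0, of "\<delta> / 2"] \<delta> by (simp add: dist_real_def)
  moreover have "\<forall>\<^sub>F i::int in at_top. i > 0" by (rule eventually_gt_at_top)
  ultimately have ev: "\<forall>\<^sub>F i in at_top. \<bar>z i\<bar> < \<delta> / 2 * real_of_int i"
    by eventually_elim (simp add: field_simps abs_if split: if_splits)
  have lin: "\<forall>\<^sub>F i in at_top. a < \<delta> / 2 * real_of_int i" for a
  proof (rule eventually_at_top_linorderI)
    fix i assume "\<lfloor>2 * a / \<delta>\<rfloor> + 1 \<le> i"
    then have "2 * a / \<delta> < real_of_int i" by linarith
    then show "a < \<delta> / 2 * real_of_int i" using \<delta>(1) by (simp add: field_simps)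
  qed
  have "\<forall>\<^sub>F i in at_top. \<bar>z i\<bar> < \<delta> / 2 * real_of_int i \<and> z n + \<delta> * n < \<delta> / 2 * real_of_int i \<and> i > n"
    using ev lin eventually_gt_at_top by (intro eventually_conj)
  \<comment> \<open>The peak is placed so far out that its value beats the left endpoint
    \<open>n\<close>, where no inequality is assumed. Half of the slope absorbs \<open>z\<close>,
    the other half decides the comparison.\<close>
  then obtain m where m: "\<bar>z m\<bar> < \<delta> / 2 * real_of_int m" "z n + \<delta> * n < \<delta> / 2 * real_of_int m" "m > n"
    by (auto simp: eventually_at_top_linorder)
  define g where "g i = z i - \<delta> * \<bar>real_of_int (i - m)\<bar>" for i
  have gm: "g m > g n"
    using m by (simp add: g_def algebra_simps)
  have "\<forall>\<^sub>F i in at_top. \<bar>z i\<bar> < \<delta> / 2 * real_of_int i \<and> \<delta> * m - g m < \<delta> / 2 * real_of_int i \<and> i > m"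
    using ev lin eventually_gt_at_top by (intro eventually_conj)
  then obtain N where N: "\<And>i. i \<ge> N \<Longrightarrow> \<bar>z i\<bar> < \<delta> / 2 * real_of_int i"
      "\<And>i. i \<ge> N \<Longrightarrow> \<delta> * m - g m < \<delta> / 2 * real_of_int i" "\<And>i. i \<ge> N \<Longrightarrow> i > m"
    by (auto simp: eventually_at_top_linorder)
  have far: "g i < g m" if "i \<ge> N" for i
    using N[OF that] by (simp add: g_def algebra_simps)
  have "m < N" using N(3)[of N] by simp
  define I where "I = {n..N}"
  have I: "finite (g ` I)" "m \<in> I" using m \<open>m < N\<close> by (auto simp: I_def)
  then have "Max (g ` I) \<in> g ` I" by (intro Max_in) auto
  then obtain k where k: "k \<in> I" "g k = Max (g ` I)" by auto
  have kmax': "g i \<le> g k" if "i \<in> I" for i using k I that by simp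
  have kmax: "g i \<le> g k" if "i \<ge> n" for i
    using kmax'[of i] kmax'[of m] far[of i] that I(2) by (cases "i \<le> N") (auto simp: I_def)
  have kn: "k > n" using kmax[of m] gm m k by (cases "k = n") (auto simp: I_def)
  \<comment> \<open>Maximality at \<open>k\<close>, exponentiated: the tent changes by at most
    \<open>\<delta>\<close> between neighbours, so \<open>\<phi> / \<psi>\<close> grows by at most
    the factor \<open>exp \<delta>\<close>.\<close>
  have key: "exp (- \<delta>) * (\<phi> j * \<psi> k) \<le> \<phi> k * \<psi> j" if j: "j = k + 1 \<or> j = k - 1" for j
  proof -
    have jn: "j \<ge> n" using j kn by auto
    have "\<bar>real_of_int (j - m)\<bar> \<le> \<bar>real_of_int (k - m)\<bar> + 1" using j by auto
    then have "\<delta> * \<bar>real_of_int (j - m)\<bar> \<le> \<delta> * \<bar>real_of_int (k - m)\<bar> + \<delta> * 1"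
      unfolding distrib_left[symmetric] using \<delta>(1) by (intro mult_left_mono) auto
    then have "- \<delta> + (ln (\<phi> j) + ln (\<psi> k)) \<le> ln (\<phi> k) + ln (\<psi> j)"
      using kmax[OF jn] by (simp add: g_def z_def)
    then have "exp (- \<delta>) * (exp (ln (\<phi> j)) * exp (ln (\<psi> k))) \<le> exp (ln (\<phi> k)) * exp (ln (\<psi> j))"
      unfolding exp_add[symmetric] by simp
    then show ?thesis using pos[OF jn] pos[of k] kn by simp
  qed
  define a b e where "a = d (k + 1) * exp p" and "b = d k * exp (- p)" and "e = c k - d k - d (k + 1)"
  have ab: "a \<ge> 0" "b \<ge> 0" by (auto simp: a_def b_def)
  have L\<phi>: "l * \<phi> k \<le> a * \<phi> (k + 1) + b * \<phi> (k - 1) + e * \<phi> k"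
    and L\<psi>: "a * \<psi> (k + 1) + b * \<psi> (k - 1) + e * \<psi> k \<le> u * \<psi> k"
    using sub[OF kn] sup[OF kn] unfolding Lp_op_eq a_def b_def e_def by auto
  have pk: "\<phi> k > 0" "\<psi> k > 0" using pos[of k] kn by auto
  have "a * \<phi> (k + 1) \<le> (K * exp p) * (Q * \<phi> k)"
    using Q(2)[of k] kn d_le K1 pos[of "k+1"] unfolding a_def by (intro mult_mono) auto
  moreover have "b * \<phi> (k - 1) \<le> (K * exp (- p)) * (Q * \<phi> k)"
    using Q(3)[of "k - 1"] kn d_le K1 pos[of "k-1"] unfolding b_def by (intro mult_mono) auto
  ultimately have S: "a * \<phi> (k + 1) + b * \<phi> (k - 1) \<le> C * \<phi> k" (is "?S \<le> _")
    unfolding C_def by (simp add: algebra_simps)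
  have S0: "?S \<ge> 0" using ab pos[of "k+1"] pos[of "k-1"] kn by (simp add: add_nonneg_nonneg less_imp_le)
  have "1 - exp (- \<delta>) \<le> \<delta>" using exp_ge_add_one_self[of "- \<delta>"] by linarith
  then have "(1 - exp (- \<delta>)) * ?S \<le> \<delta> * ?S" using S0 by (rule mult_right_mono)
  also have "\<dots> \<le> \<delta> * (C * \<phi> k)" using S \<delta>(1) by (intro mult_left_mono) auto
  finally have T: "?S - \<delta> * C * \<phi> k \<le> exp (- \<delta>) * ?S" by (simp add: algebra_simps)
  have "exp (- \<delta>) * ?S * \<psi> k = a * (exp (- \<delta>) * (\<phi> (k+1) * \<psi> k)) + b * (exp (- \<delta>) * (\<phi> (k-1) * \<psi> k))"
    by (simp add: algebra_simps)
  also have "\<dots> \<le> a * (\<phi> k * \<psi> (k + 1)) + b * (\<phi> k * \<psi> (k - 1))"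
    using key ab by (intro add_mono mult_left_mono) auto
  also have "\<dots> = \<phi> k * (a * \<psi> (k + 1) + b * \<psi> (k - 1))" by (simp add: algebra_simps)
  also have "\<dots> \<le> \<phi> k * (u * \<psi> k - e * \<psi> k)" using L\<psi> pk by (intro mult_left_mono) auto
  finally have 1: "exp (- \<delta>) * ?S * \<psi> k \<le> (u - e) * \<phi> k * \<psi> k" by (simp add: algebra_simps)
  have "(l - e - \<delta> * C) * \<phi> k \<le> exp (- \<delta>) * ?S" using T L\<phi> by (simp add: algebra_simps)
  then have "(l - e - \<delta> * C) * \<phi> k * \<psi> k \<le> exp (- \<delta>) * ?S * \<psi> k" using pk by (intro mult_right_mono) auto
  with 1 have "(l - e - \<delta> * C) * (\<phi> k * \<psi> k) \<le> (u - e) * (\<phi> k * \<psi> k)" by (simp add: mult.assoc)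
  then have "l - e - \<delta> * C \<le> u - e" using pk by (simp add: mult_le_cancel_right)
  then show False using \<delta> by linarith
qed

lemma H_lower_le_H_upper: "H_lower c d p \<le> H_upper c d p"
proof -
  have le: "lower_eigenvalue c d p n \<le> upper_eigenvalue c d p n" for n
    unfolding lower_eigenvalue_def upper_eigenvalue_def
  proof (intro Sup_least Inf_greatest, clarify)
    fix l u \<phi> \<psi>
    assume "\<phi> \<in> test_functions n" "\<forall>i>n. l * \<phi> i \<le> Lp_op c d p \<phi> i"
      "\<psi> \<in> test_functions n" "\<forall>i>n. Lp_op c d p \<psi> i \<le> u * \<psi> i"
    then have "l \<le> u" by (intro sub_le_super[of \<phi> n l p \<psi> u]) auto
    then show "ereal l \<le> ereal u" by simp
  qed
  have "lower_eigenvalue c d p n \<le> upper_eigenvalue c d p m" for n m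
    using lower_eigenvalue_mono[of n "max n m" c d p] le[of "max n m"]
      upper_eigenvalue_antimono[of m "max n m" c d p] by (meson max.cobounded1 max.cobounded2 order_trans)
  then show ?thesis unfolding H_lower_SUP H_upper_INF by (intro SUP_least INF_greatest)
qed

end

section \<open>Test functions built from ratios of prescribed logarithmic mean\<close>

definition rate :: "(int \<Rightarrow> real) \<Rightarrow> real \<Rightarrow> bool" where
  "rate r q \<longleftrightarrow> (\<lambda>n. (\<Sum>i<n. ln (r (int i))) / real n) \<longlonglongrightarrow> q"

text \<open>The function with value \<open>1\<close> at \<open>0\<close> and ratios
  \<open>r\<close>, divided by \<open>exp (q * i)\<close>. If \<open>r\<close> has rate
  \<open>q\<close>, what remains is subexponential.\<close>

definition from_ratio :: "(int \<Rightarrow> real) \<Rightarrow> real \<Rightarrow> int \<Rightarrow> real" where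
  "from_ratio r q i = exp ((\<Sum>j<nat i. ln (r (int j))) - q * real_of_int i)"

lemma from_ratio_Suc:
  assumes "i \<ge> 0" "r i > 0"
  shows "from_ratio r q (i + 1) = from_ratio r q i * (r i * exp (- q))"
proof -
  have "nat (i + 1) = Suc (nat i)" using assms by simp
  then show ?thesis using assms unfolding from_ratio_def
    by (simp add: exp_add exp_diff algebra_simps exp_minus divide_simps)
qed

lemma from_ratio_test_function:
  assumes r: "\<And>i. i \<ge> 0 \<Longrightarrow> r i > 0" "\<And>i. i \<ge> 0 \<Longrightarrow> r i \<le> Q" "\<And>i. i \<ge> 0 \<Longrightarrow> 1 / r i \<le> Q"
    and q: "rate r q"
  shows "from_ratio r q \<in> test_functions 0"
proof -
  have pos: "from_ratio r q i > 0" for i by (simp add: from_ratio_def)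
  have "((\<lambda>i. (\<Sum>j<nat i. ln (r (int j))) / real (nat i) - q) \<longlongrightarrow> q - q) at_top"
    using q unfolding rate_def
    by (intro tendsto_intros filterlim_compose[OF _ filterlim_nat_sequentially]) 
  moreover have "\<forall>\<^sub>F i in at_top. (\<Sum>j<nat i. ln (r (int j))) / real (nat i) - q = ln (from_ratio r q i) / real_of_int i"
    using eventually_gt_at_top[of "0::int"] by eventually_elim (simp add: from_ratio_def field_simps)
  ultimately have lim: "((\<lambda>i. ln (from_ratio r q i) / real_of_int i) \<longlongrightarrow> 0) at_top"
    by (simp add: filterlim_cong)
  have "\<bar>(from_ratio r q (i + 1) - from_ratio r q i) / from_ratio r q i\<bar> \<le> Q * exp (- q) + 1" if "i \<ge> 0" for i
  proof -
    have "(from_ratio r q (i + 1) - from_ratio r q i) / from_ratio r q i = r i * exp (- q) - 1"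
      using from_ratio_Suc[of i r q] that r(1)[OF that] pos[of i] by (simp add: field_simps)
    moreover have "0 < r i * exp (- q)" "r i * exp (- q) \<le> Q * exp (- q)" using r that by auto
    ultimately show ?thesis by linarith
  qed
  then have b1: "bounded ((\<lambda>i. (from_ratio r q (i + 1) - from_ratio r q i) / from_ratio r q i) ` {0..})"
    by (intro boundedI[where B="Q * exp (- q) + 1"]) auto
  have "\<bar>(from_ratio r q (i + 1) - from_ratio r q i) / from_ratio r q (i + 1)\<bar> \<le> Q * exp q + 1" if "i \<ge> 0" for i
  proof -
    have "(from_ratio r q (i + 1) - from_ratio r q i) / from_ratio r q (i + 1) = 1 - 1 / r i * exp q"
      unfolding from_ratio_Suc[of i r q, OF that r(1)[OF that]] using pos[of i] r(1)[OF that]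
      by (simp add: field_simps exp_minus)
    moreover have "0 < 1 / r i * exp q" "1 / r i * exp q \<le> Q * exp q"
      using r(1)[OF that] mult_right_mono[OF r(3)[OF that], of "exp q"] by simp_all
    ultimately show ?thesis by linarith
  qed
  then have b2: "bounded ((\<lambda>i. (from_ratio r q (i + 1) - from_ratio r q i) / from_ratio r q (i + 1)) ` {0..})"
    by (intro boundedI[where B="Q * exp q + 1"]) auto
  show ?thesis using pos lim b1 b2 by (simp add: test_functions_def)
qed

context bounded_coeffs
begin

lemma Lp_op_from_ratio:
  assumes "i > 0" "r i > 0" "r (i - 1) > 0"
  shows "Lp_op c d q (from_ratio r q) i =
    (d (i + 1) * r i + d i / r (i - 1) - v 0 i) * from_ratio r q i"
proof -
  have 1: "from_ratio r q (i + 1) = from_ratio r q i * (r i * exp (- q))"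
    using assms by (intro from_ratio_Suc) auto
  have "from_ratio r q i = from_ratio r q (i - 1) * (r (i - 1) * exp (- q))"
    using from_ratio_Suc[of "i - 1" r q] assms by simp
  then have 2: "from_ratio r q (i - 1) = from_ratio r q i * (exp q / r (i - 1))"
    using assms(3) by (simp add: exp_minus field_simps)
  have 3: "d (i + 1) * exp q * (x * (r i * exp (- q))) = d (i + 1) * r i * x"
    "d i * exp (- q) * (x * (exp q / r (i - 1))) = d i / r (i - 1) * x" for x
    by (simp_all add: exp_minus field_simps)
  show ?thesis unfolding Lp_op_eq 1 2 3 by (simp add: v_def algebra_simps)
qed

lemma H_lower_ge_ratio:
  assumes r: "\<And>i. i \<ge> 0 \<Longrightarrow> r i > 0" "\<And>i. i \<ge> 0 \<Longrightarrow> r i \<le> Q" "\<And>i. i \<ge> 0 \<Longrightarrow> 1 / r i \<le> Q"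
    and q: "rate r q"
    and sub: "\<And>i. i > 0 \<Longrightarrow> v l i \<le> d (i + 1) * r i + d i / r (i - 1)"
  shows "ereal l \<le> H_lower c d q"
proof (rule H_lower_ge[OF from_ratio_test_function[OF r q]])
  fix i :: int assume i: "i > 0"
  have "v l i - v 0 i = l" by (simp add: v_def)
  then have "l \<le> d (i + 1) * r i + d i / r (i - 1) - v 0 i" using sub[OF i] by linarith
  then show "l * from_ratio r q i \<le> Lp_op c d q (from_ratio r q) i"
    using i r by (subst Lp_op_from_ratio) (auto intro!: mult_right_mono simp: from_ratio_def)
qed

lemma H_upper_le_ratio:
  assumes r: "\<And>i. i \<ge> 0 \<Longrightarrow> r i > 0" "\<And>i. i \<ge> 0 \<Longrightarrow> r i \<le> Q" "\<And>i. i \<ge> 0 \<Longrightarrow> 1 / r i \<le> Q"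
    and q: "rate r q"
    and sup: "\<And>i. i > 0 \<Longrightarrow> d (i + 1) * r i + d i / r (i - 1) \<le> v l i"
  shows "H_upper c d q \<le> ereal l"
proof (rule H_upper_le[OF from_ratio_test_function[OF r q]])
  fix i :: int assume i: "i > 0"
  have "v l i - v 0 i = l" by (simp add: v_def)
  then have "d (i + 1) * r i + d i / r (i - 1) - v 0 i \<le> l" using sup[OF i] by linarith
  then show "Lp_op c d q (from_ratio r q) i \<le> l * from_ratio r q i"
    using i r by (subst Lp_op_from_ratio) (auto intro!: mult_right_mono simp: from_ratio_def)
qed

lemma H_eq_of_rmin_rate:
  assumes a: "has_supersolutions l" and q: "rate (minimal_ratio l) q"
  shows "H_lower c d q = ereal l" "H_upper c d q = ereal l"
proof -
  have r: "1 / minimal_ratio l i \<le> B l" for i using minimal_ratio_ge[of l i] minimal_ratio_pos[of l i] by (simp add: field_simps)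
  have "ereal l \<le> H_lower c d q"
    by (rule H_lower_ge_ratio[where Q="B l", OF _ _ _ q]) (use minimal_ratio_pos minimal_ratio_le_B r minimal_ratio_eq[OF a] in auto)
  moreover have "H_upper c d q \<le> ereal l"
    by (rule H_upper_le_ratio[where Q="B l", OF _ _ _ q]) (use minimal_ratio_pos minimal_ratio_le_B r minimal_ratio_eq[OF a] in auto)
  ultimately show "H_lower c d q = ereal l" "H_upper c d q = ereal l"
    using H_lower_le_H_upper[of q] by auto
qed

text \<open>For the constant test function the two exponential terms have product
  \<open>d (i + 1) * d i\<close>, so by the inequality of arithmetic and geometric means their sum
  is at least twice its square root, whatever \<open>p\<close> is.\<close>

lemma H_lower_ge_of_Liminf:
  assumes "\<And>i. i > n \<Longrightarrow> c i - (sqrt (d (i + 1)) - sqrt (d i))\<^sup>2 \<ge> \<delta>"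
  shows "ereal \<delta> \<le> H_lower c d p"
proof (rule H_lower_ge[of "\<lambda>_. 1" n])
  show "(\<lambda>_. 1) \<in> test_functions n" by (auto simp: test_functions_def image_constant_conv)
  fix i assume i: "i > n"
  define x y where "x = sqrt (d (i + 1) * exp p)" and "y = sqrt (d i * exp (- p))"
  have "0 \<le> (x - y)\<^sup>2" by simp
  also have "\<dots> = x\<^sup>2 + y\<^sup>2 - 2 * (x * y)" by (simp add: power2_diff)
  also have "x\<^sup>2 = d (i + 1) * exp p" by (simp add: x_def)
  also have "y\<^sup>2 = d i * exp (- p)" by (simp add: y_def)
  also have "x * y = sqrt (d (i + 1)) * sqrt (d i)"
    unfolding x_def y_def by (simp add: real_sqrt_mult[symmetric] exp_minus)
  finally have "d (i + 1) * exp p + d i * exp (- p) \<ge> 2 * (sqrt (d (i + 1)) * sqrt (d i))" by simp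
  moreover have "(sqrt (d (i + 1)) - sqrt (d i))\<^sup>2 = d (i + 1) + d i - 2 * (sqrt (d (i + 1)) * sqrt (d i))"
    by (simp add: power2_diff)
  ultimately show "\<delta> * 1 \<le> Lp_op c d p (\<lambda>_. 1) i"
    using assms[OF i] by (simp add: Lp_op_eq)
qed

end

section \<open>Subsolutions of prescribed rate\<close>

text \<open>A run of zeros from \<open>i\<close> to \<open>i + s\<close> leaves the partial sum
  unchanged, while both sums are close to \<open>a\<close> times their length; hence
  \<open>(1 - \<eta>) * (i + s) \<le> (1 + \<eta>) * i\<close>.\<close>

lemma sublinear_gaps:
  fixes h :: "nat \<Rightarrow> real"
  assumes lim: "(\<lambda>n. (\<Sum>i<n. h i) / real n) \<longlonglongrightarrow> a" and "a > 0" "\<kappa> > 0"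
  shows "\<exists>C\<ge>0. \<forall>i s. (\<forall>j<s. h (i + j) = 0) \<longrightarrow> real s \<le> \<kappa> * real i + C"
proof -
  \<comment> \<open>Solves \<open>2 * \<eta> / (1 - \<eta>) = \<kappa>\<close>.\<close>
  define \<eta> where "\<eta> = \<kappa> / (2 + \<kappa>)"
  have \<eta>: "0 < \<eta>" "\<eta> < 1" using \<open>\<kappa> > 0\<close> by (auto simp: \<eta>_def field_simps)
  define N where "N n = (\<Sum>i<n. h i)" for n
  have "\<forall>\<^sub>F n in sequentially. \<bar>N n / real n - a\<bar> < \<eta> * a"
    using tendstoD[OF lim, of "\<eta> * a"] \<eta> \<open>a > 0\<close> by (simp add: dist_real_def N_def)
  then have "\<forall>\<^sub>F n in sequentially. \<bar>N n / real n - a\<bar> < \<eta> * a \<and> n > 0"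
    using eventually_gt_at_top[of 0] by (rule eventually_conj)
  then obtain n0 where n0: "\<And>n. n \<ge> n0 \<Longrightarrow> \<bar>N n / real n - a\<bar> < \<eta> * a \<and> n > 0"
    by (auto simp: eventually_sequentially)
  have Nge: "N n \<ge> (1 - \<eta>) * a * real n" and Nle: "N n \<le> (1 + \<eta>) * a * real n" if "n \<ge> n0" for n
  proof -
    have "N n / real n > (1 - \<eta>) * a" "N n / real n < (1 + \<eta>) * a" "n > 0"
      using n0[OF that] by (auto simp: algebra_simps abs_less_iff)
    then show "N n \<ge> (1 - \<eta>) * a * real n" "N n \<le> (1 + \<eta>) * a * real n"
      by (auto simp: field_simps)
  qed
  have big: "real s \<le> \<kappa> * real i" if "i \<ge> n0" and z: "\<forall>j<s. h (i + j) = 0" for i s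
  proof -
    have "N (i + s) = N i"
      unfolding N_def using z by (induction s) auto
    then have "(1 - \<eta>) * a * real (i + s) \<le> (1 + \<eta>) * a * real i"
      using Nge[of "i + s"] Nle[of i] that by simp
    then have "a * ((1 - \<eta>) * real (i + s)) \<le> a * ((1 + \<eta>) * real i)" by (simp add: algebra_simps)
    then have "(1 - \<eta>) * real (i + s) \<le> (1 + \<eta>) * real i" using \<open>a > 0\<close> by simp
    then have "(1 - \<eta>) * real s \<le> 2 * \<eta> * real i" by (simp add: algebra_simps)
    moreover have "1 - \<eta> = 2 / (2 + \<kappa>)" using \<open>\<kappa> > 0\<close> by (simp add: \<eta>_def field_simps)
    ultimately have "2 * real s / (2 + \<kappa>) \<le> 2 * (\<kappa> * real i) / (2 + \<kappa>)" by (simp add: \<eta>_def)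
    then show ?thesis using \<open>\<kappa> > 0\<close> by (simp only: divide_le_cancel) auto
  qed
  show ?thesis
  \<comment> \<open>A gap starting before \<open>n0\<close> is cut at \<open>n0\<close>: the first
    piece has length at most \<open>n0\<close>, the rest at most
    \<open>\<kappa> * n0\<close>.\<close>
  proof (intro exI[of _ "real n0 + \<kappa> * real n0"] conjI allI impI)
    show "0 \<le> real n0 + \<kappa> * real n0" using \<open>\<kappa> > 0\<close> by simp
    fix i s assume z: "\<forall>j<s. h (i + j) = 0"
    have ki: "0 \<le> \<kappa> * real i" "0 \<le> \<kappa> * real n0" using \<open>\<kappa> > 0\<close> by auto
    show "real s \<le> \<kappa> * real i + (real n0 + \<kappa> * real n0)"
    proof (cases "i \<ge> n0")
      case True
      then show ?thesis using big[OF True z] ki by linarith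
    next
      case False
      show ?thesis
      proof (cases "s \<ge> n0 - i")
        case True
        have "h (n0 + j) = 0" if "j < s - (n0 - i)" for j
        proof -
          have "n0 - i + j < s" "i + (n0 - i + j) = n0 + j" using that True False by auto
          then show ?thesis using z by metis
        qed
        then have "real (s - (n0 - i)) \<le> \<kappa> * real n0" by (intro big) auto
        moreover have "real s \<le> real (s - (n0 - i)) + real n0" by linarith
        ultimately show ?thesis using ki by linarith
      qed (use ki in linarith)
    qed
  qed
qed

context bounded_coeffs
begin

lemma riccati_le: assumes "x > 0" "Q \<ge> B l" shows "riccati l i x \<le> Q"
proof -
  have "d i / x \<ge> 0" using assms by (simp add: less_imp_le)
  then have "riccati l i x \<le> v l i / d (i + 1)" unfolding riccati_def by (intro divide_right_mono) auto
  then show ?thesis using v_div_le_B[of l i "i + 1"] assms by linarith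
qed

lemma riccati_mono: assumes "0 < x" "x \<le> y" shows "riccati l i x \<le> riccati l i y"
proof -
  have "d i / y \<le> d i / x" using assms by (intro divide_left_mono) auto
  then show ?thesis unfolding riccati_def by (intro divide_right_mono) auto
qed

text \<open>From \<open>1 / Q\<close> the Riccati map even gives a nonpositive value, so the floor
  is absorbing.\<close>

lemma riccati_low: assumes "Q \<ge> B l" shows "riccati l i (1 / Q) \<le> 1 / Q"
proof -
  have Q: "Q > 0" using assms B_pos[of l] by linarith
  have "v l i / d i \<le> Q" using v_div_le_B[of l i i] assms by linarith
  then have "v l i - d i / (1 / Q) \<le> 0" by (simp add: pos_divide_le_eq mult.commute)
  then have "riccati l i (1 / Q) \<le> 0" unfolding riccati_def by (simp add: divide_nonpos_pos)
  then show ?thesis using Q by (smt (verit) divide_pos_pos)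
qed

lemma sub_iff_F_le: "x > 0 \<Longrightarrow> riccati l i x \<le> y \<longleftrightarrow> v l i \<le> d (i + 1) * y + d i / x"
  unfolding riccati_def by (simp add: pos_divide_le_eq algebra_simps)

section \<open>The truncated forward iteration, its restarts and its hitting times\<close>

context
  fixes l Q :: real
  assumes QB: "Q \<ge> B l"
begin

lemma Q1: "Q \<ge> 1" "Q > 0" using QB B_ge_1[of l] by auto

lemma forward_riccati_ge: "forward_riccati l Q a t \<ge> 1 / Q"
proof (cases t)
  case 0
  show ?thesis using order_trans[of "1 / Q" 1 Q] Q1 0 by simp
qed simp

lemma forward_riccati_pos: "forward_riccati l Q a t > 0"
  using forward_riccati_ge[of a t] Q1 by (smt (verit) divide_pos_pos)

lemma forward_riccati_stick: "forward_riccati l Q a t = 1 / Q \<Longrightarrow> forward_riccati l Q a (t + s) = 1 / Q"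
  by (induction s) (use riccati_low[OF QB] in auto)

text \<open>Restarting from \<open>Q\<close> one site later never lowers the iterate:
  \<open>Q\<close> dominates every value and the Riccati map is monotone. Consequently, once some
  later start has hit the floor, the earlier one has too.\<close>

lemma forward_riccati_shift: "forward_riccati l Q a (Suc t) \<le> forward_riccati l Q (a + 1) t"
proof (induction t)
  case 0
  show ?case using forward_riccati_ge[of a 0] riccati_le[OF forward_riccati_pos QB, of _ a 0] by simp
next
  case (Suc t)
  have "riccati l (a + int (Suc t) + 1) (forward_riccati l Q a (Suc t)) \<le> riccati l (a + int (Suc t) + 1) (forward_riccati l Q (a + 1) t)"
    by (rule riccati_mono[OF forward_riccati_pos Suc])
  moreover have "a + int (Suc t) + 1 = a + 1 + int t + 1" by simp
  ultimately show ?case unfolding forward_riccati.simps(2)[of l Q a "Suc t"] forward_riccati.simps(2)[of l Q "a + 1" t]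
    by (intro max.mono) auto
qed

lemma forward_riccati_shift': "forward_riccati l Q a (t + s) \<le> forward_riccati l Q (a + int s) t"
proof (induction s arbitrary: t)
  case (Suc s)
  have "forward_riccati l Q a (t + Suc s) \<le> forward_riccati l Q (a + int s) (Suc t)" using Suc[of "Suc t"] by simp
  also have "\<dots> \<le> forward_riccati l Q (a + int s + 1) t" by (rule forward_riccati_shift)
  finally show ?case by (simp add: algebra_simps)
qed simp

text \<open>If the floor is never active, the iteration solves the Riccati equation exactly;
  non-hitting thus produces supersolutions.\<close>

lemma forward_riccati_super:
  assumes "\<And>t. forward_riccati l Q a t > 1 / Q"
  shows "supersolution l a (\<lambda>i. forward_riccati l Q a (nat (i - a)))"
  unfolding supersolution_def
proof (intro conjI allI impI)
  fix i assume "a < i"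
  then have t: "nat (i - a) = Suc (nat (i - 1 - a))" "a + int (nat (i - 1 - a)) + 1 = i" by auto
  have "forward_riccati l Q a (nat (i - a)) = riccati l i (forward_riccati l Q a (nat (i - 1 - a)))"
    using assms[of "nat (i - a)"] unfolding t(1) forward_riccati.simps t(2) by (simp add: max_def split: if_splits)
  then have "d (i + 1) * forward_riccati l Q a (nat (i - a)) = v l i - d i / forward_riccati l Q a (nat (i - 1 - a))"
    by (simp add: riccati_def)
  then show "d (i + 1) * forward_riccati l Q a (nat (i - a)) + d i / forward_riccati l Q a (nat (i - 1 - a)) \<le> v l i" by simp
qed (rule forward_riccati_pos)

text \<open>Start the forward iteration afresh from \<open>Q\<close> while the accumulated logarithm is
  at most the target \<open>q\<close> per site, and let it run down otherwise. The overshoot is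
  controlled by the hitting time of \<open>1 / Q\<close>, which is sublinear in the site.\<close>

fun greedy :: "real \<Rightarrow> nat \<Rightarrow> real \<times> real" where
  "greedy q 0 = (Q, ln Q - q)"
| "greedy q (Suc n) =
    (let x = (if snd (greedy q n) > 0 then max (1 / Q) (riccati l (int n + 1) (fst (greedy q n))) else Q)
     in (x, snd (greedy q n) + ln x - q))"

lemma greedy_bounds: "1 / Q \<le> fst (greedy q n)" "fst (greedy q n) \<le> Q"
proof -
  have Q: "1 / Q \<le> Q" using forward_riccati_ge[of 0 0] by simp
  have "1 / Q \<le> fst (greedy q n) \<and> fst (greedy q n) \<le> Q"
  proof (induction n)
    case (Suc n)
    have "0 < 1 / Q" using Q1 by simp
    then have "fst (greedy q n) > 0" using Suc by linarith
    then show ?case using Q riccati_le[OF _ QB] by (auto simp: Let_def)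
  qed (use Q in auto)
  then show "1 / Q \<le> fst (greedy q n)" "fst (greedy q n) \<le> Q" by auto
qed

lemma greedy_sum: "(\<Sum>i<Suc n. ln (fst (greedy q i))) = snd (greedy q n) + q * real (Suc n)"
  by (induction n) (auto simp: Let_def algebra_simps)

text \<open>The second component is the surplus of the accumulated logarithm over \<open>q\<close>
  per site. It decreases only from positive values, by less than \<open>2 * ln Q\<close> per step,
  which gives the lower bound. It increases only along a run that began with nonpositive surplus and
  has not hit the floor. Such a run gains at most \<open>ln Q - q\<close> per step, and
  \<open>hit\<close> limits its length.\<close>

lemma greedy_invariant:
  assumes q: "\<bar>q\<bar> < ln Q"
    and hit: "\<And>a t. forward_riccati l Q (int a) t > 1 / Q \<Longrightarrow> real t \<le> \<kappa> * real a + C"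
    and kC: "\<kappa> \<ge> 0" "C \<ge> 0"
  shows "- 2 * ln Q \<le> snd (greedy q n) \<and> snd (greedy q n) \<le> (ln Q - q) * (\<kappa> * real n + C + 1) \<and>
    (fst (greedy q n) = 1 / Q \<or>
      (\<exists>a\<le>n. fst (greedy q n) = forward_riccati l Q (int a) (n - a) \<and> snd (greedy q n) \<le> (ln Q - q) * (real (n - a) + 1)))"
proof -
  define G where "G = ln Q - q"
  have G: "G > 0" "q > - ln Q" "q < ln Q" using q by (auto simp: G_def)
  have Gk: "G \<le> G * (\<kappa> * real n + C + 1)" for n
  proof -
    have "1 \<le> \<kappa> * real n + C + 1" using kC by simp
    then have "G * 1 \<le> G * (\<kappa> * real n + C + 1)" using G(1) by (intro mult_left_mono) auto
    then show ?thesis by simp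
  qed
  have Gmono: "G * (\<kappa> * real n + C + 1) \<le> G * (\<kappa> * real (Suc n) + C + 1)" for n
    using G(1) kC by (intro mult_left_mono) (auto simp: algebra_simps)
  have lnQ: "ln (1 / Q) = - ln Q" using Q1 by (simp add: ln_div)
  show ?thesis unfolding G_def[symmetric]
  proof (induction n)
    case 0
    have "- 2 * ln Q \<le> G" using G by linarith
    then show ?case using Gk[of 0] by (simp add: G_def)
  next
    case (Suc n)
    define x D where "x = fst (greedy q n)" and "D = snd (greedy q n)"
    note IH = Suc.IH[folded x_def D_def]
    show ?case
    proof (cases "D > 0")
      case False
      have s: "greedy q (Suc n) = (Q, D + G)" using False by (simp add: Let_def D_def G_def)
      have "fst (greedy q (Suc n)) = forward_riccati l Q (int (Suc n)) (Suc n - Suc n)"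
        "D + G \<le> G * (real (Suc n - Suc n) + 1)" unfolding s using False by auto
      moreover have "D + G \<le> G * (\<kappa> * real (Suc n) + C + 1)" using Gk[of "Suc n"] False by linarith
      moreover have "- 2 * ln Q \<le> D + G" using IH G by linarith
      ultimately show ?thesis unfolding s snd_conv by blast
    next
      case True
      define x' where "x' = max (1 / Q) (riccati l (int n + 1) x)"
      have s: "greedy q (Suc n) = (x', D + ln x' - q)"
        using True by (simp add: Let_def D_def x_def x'_def)
      have x': "1 / Q \<le> x'" "x' \<le> Q" using greedy_bounds[of q "Suc n"] unfolding s by auto
      have x'0: "x' > 0" using x'(1) Q1 by (smt (verit) divide_pos_pos)
      have "ln (1 / Q) \<le> ln x'" "ln x' \<le> ln Q" using x' x'0 Q1 by simp_all
      then have lnx': "- ln Q \<le> ln x'" "ln x' \<le> ln Q" using lnQ by auto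
      have low: "- 2 * ln Q \<le> D + ln x' - q" using lnx' True G by linarith
      have stop: ?thesis if "x' = 1 / Q"
      proof -
        have "D + ln x' - q \<le> D" using lnQ G that by simp
        then have "D + ln x' - q \<le> G * (\<kappa> * real (Suc n) + C + 1)" using IH Gmono[of n] by linarith
        then show ?thesis unfolding s fst_conv snd_conv using low that by blast
      qed
      show ?thesis
      proof (cases "x' = 1 / Q")
        case False
        \<comment> \<open>The floor is absorbing while the surplus is positive, so a value above it
          belongs to a run that has not hit; the induction hypothesis supplies the start
          \<open>a\<close> of this run.\<close>
        then have "x \<noteq> 1 / Q" using riccati_low[OF QB, of "int n + 1"] by (auto simp: x'_def max_def)
        then obtain a where a: "a \<le> n" "x = forward_riccati l Q (int a) (n - a)" "D \<le> G * (real (n - a) + 1)"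
          using IH by blast
        have "int a + int (n - a) + 1 = int n + 1" using a(1) by simp
        then have fx: "x' = forward_riccati l Q (int a) (Suc (n - a))" unfolding x'_def a(2) by simp
        then have "forward_riccati l Q (int a) (Suc (n - a)) > 1 / Q" using False x' by simp
        from hit[OF this] have h: "real (Suc (n - a)) \<le> \<kappa> * real (Suc n) + C"
          using mult_left_mono[of "real a" "real (Suc n)" \<kappa>] a(1) kC by simp
        have sa: "Suc n - a = Suc (n - a)" using a(1) by simp
        have D': "D + ln x' - q \<le> G * (real (Suc n - a) + 1)"
          using a(3) lnx'(2) unfolding sa by (simp add: G_def algebra_simps)
        also have "\<dots> \<le> G * (\<kappa> * real (Suc n) + C + 1)"
          using h G(1) unfolding sa by (intro mult_left_mono) auto
        finally show ?thesis unfolding s fst_conv snd_conv using low D' fx sa a(1)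
          by (metis le_SucI)
      qed (rule stop)
    qed
  qed
qed

text \<open>Each greedy ratio is at least the Riccati image of its predecessor, also after a jump to
  \<open>Q\<close>, so the subsolution inequality persists. The surplus is sublinear, so the rate is
  exactly \<open>q\<close>.\<close>

lemma H_lower_ge_greedy:
  assumes q: "\<bar>q\<bar> < ln Q"
    and hit: "\<And>\<kappa>. \<kappa> > 0 \<Longrightarrow> \<exists>C\<ge>0. \<forall>a t. forward_riccati l Q (int a) t > 1 / Q \<longrightarrow> real t \<le> \<kappa> * real a + C"
  shows "ereal l \<le> H_lower c d q"
proof -
  define D where "D n = snd (greedy q n)" for n
  have "(\<lambda>n. D n / real (Suc n)) \<longlonglongrightarrow> 0"
  proof (rule LIMSEQ_I)
    fix e :: real assume e: "e > 0"
    define G where "G = ln Q - q"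
    have G: "G > 0" using q by (auto simp: G_def)
    obtain C where C: "C \<ge> 0" "\<And>a t. forward_riccati l Q (int a) t > 1 / Q \<Longrightarrow> real t \<le> e / (2 * G) * real a + C"
      using hit[of "e / (2 * G)"] e G by auto
    have inv: "- 2 * ln Q \<le> D n \<and> D n \<le> G * (e / (2 * G) * real n + C + 1)" for n
      using greedy_invariant[OF q C(2) _ C(1), of n] e G unfolding D_def G_def by auto
    obtain n0 where n0: "real n0 > 2 * (G * (C + 1)) / e + 2 * ln Q / e"
      using reals_Archimedean2 by blast
    have lnQ: "ln Q \<ge> 0" using Q1 by simp
    have "norm (D n / real (Suc n) - 0) < e" if "n \<ge> n0" for n
    proof -
      have "real n > 2 * (G * (C + 1)) / e + 2 * ln Q / e" using n0 that by linarith
      then have "real n * e > 2 * (G * (C + 1)) + 2 * ln Q"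
        using e by (simp add: field_simps)
      moreover have "G * (C + 1) \<ge> 0" using G C by simp
      moreover have "G * (e / (2 * G) * real n + C + 1) = e * real n / 2 + G * (C + 1)"
        using G by (simp add: field_simps)
      ultimately have "D n < e * real (Suc n)" "- D n < e * real (Suc n)"
        using inv[of n] e lnQ by (auto simp: algebra_simps)
      then show ?thesis by (simp add: abs_less_iff field_simps)
    qed
    then show "\<exists>no. \<forall>n\<ge>no. norm (D n / real (Suc n) - 0) < e" by blast
  qed
  then have "(\<lambda>n. D n / real (Suc n) + q) \<longlonglongrightarrow> 0 + q" by (intro tendsto_intros)
  moreover have "D n / real (Suc n) + q = (\<Sum>i<Suc n. ln (fst (greedy q (nat (int i))))) / real (Suc n)" for n
    unfolding nat_int greedy_sum D_def by (simp add: field_simps)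
  ultimately have "(\<lambda>n. (\<Sum>i<Suc n. ln (fst (greedy q (nat (int i))))) / real (Suc n)) \<longlonglongrightarrow> q"
    by simp
  then have rt: "rate (\<lambda>i. fst (greedy q (nat i))) q"
    unfolding rate_def by (subst (asm) filterlim_sequentially_Suc)
  have pos: "fst (greedy q n) > 0" for n
    using greedy_bounds(1)[of q n] Q1 by (smt (verit) divide_pos_pos)
  show ?thesis
  proof (rule H_lower_ge_ratio[where Q=Q, OF _ _ _ rt])
    fix i :: int
    show "1 / fst (greedy q (nat i)) \<le> Q"
      using greedy_bounds(1)[of q "nat i"] pos[of "nat i"] Q1 by (simp add: field_simps)
    assume i: "i > 0"
    then have n: "nat i = Suc (nat (i - 1))" "int (nat (i - 1)) + 1 = i" by auto
    have "riccati l i (fst (greedy q (nat (i - 1)))) \<le> fst (greedy q (nat i))"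
      unfolding n(1) using riccati_le[OF pos QB] n(2) by (simp add: Let_def)
    then show "v l i \<le> d (i + 1) * fst (greedy q (nat i)) + d i / fst (greedy q (nat (i - 1)))"
      using sub_iff_F_le[OF pos] by simp
  qed (use pos greedy_bounds in auto)
qed

text \<open>If the start \<open>i\<close> has not hit by time \<open>t\<close>, then no start
  \<open>i + j\<close> with \<open>j < t - m\<close> hits within \<open>m\<close> steps. This is a
  gap of length \<open>t - m\<close> in a hitting indicator of positive density.\<close>

lemma hitting_time_sublinear:
  assumes lim: "(\<lambda>n. (\<Sum>i<n. of_bool (forward_riccati l Q (int i) m = 1 / Q)) / real n) \<longlonglongrightarrow> a"
    and "a > 0" "\<kappa> > 0"
  shows "\<exists>C\<ge>0. \<forall>a t. forward_riccati l Q (int a) t > 1 / Q \<longrightarrow> real t \<le> \<kappa> * real a + C"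
proof -
  obtain C where C: "C \<ge> 0" "\<And>i s. (\<forall>j<s. (of_bool (forward_riccati l Q (int (i + j)) m = 1 / Q) :: real) = 0) \<Longrightarrow>
      real s \<le> \<kappa> * real i + C"
    using sublinear_gaps[OF lim \<open>a > 0\<close> \<open>\<kappa> > 0\<close>] by auto
  have "real t \<le> \<kappa> * real i + (C + real m)" if t: "forward_riccati l Q (int i) t > 1 / Q" for i t
  proof -
    have "forward_riccati l Q (int (i + j)) m \<noteq> 1 / Q" if j: "j < t - m" for j
    proof
      assume "forward_riccati l Q (int (i + j)) m = 1 / Q"
      then have "forward_riccati l Q (int (i + j)) (m + (t - j - m)) = 1 / Q" by (rule forward_riccati_stick)
      then have "forward_riccati l Q (int (i + j)) (t - j) = 1 / Q" using j by simp
      moreover have "forward_riccati l Q (int i) (t - j + j) \<le> forward_riccati l Q (int i + int j) (t - j)" by (rule forward_riccati_shift')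
      ultimately show False using t j by simp
    qed
    then have "real (t - m) \<le> \<kappa> * real i + C" by (intro C(2)) auto
    then show ?thesis by linarith
  qed
  then show ?thesis using C(1) by (intro exI[of _ "C + real m"]) auto
qed

end

end

section \<open>Stationary ergodic coefficients\<close>

lemma ratio_maximizer:
  fixes G :: "real \<Rightarrow> real"
  assumes cont: "continuous_on {a..} G" and "a > 0"
    and sub: "\<And>s. s > 0 \<Longrightarrow> \<exists>C. \<forall>l\<ge>a. G l \<le> s * l + C"
    and pos: "\<exists>l\<ge>a. G l > 0"
  shows "\<exists>l\<ge>a. G l > 0 \<and> (\<forall>l'\<ge>a. G l' / l' \<le> G l / l)"
proof -
  obtain l1 where l1: "l1 \<ge> a" "G l1 > 0" using pos by blast
  define s where "s = G l1 / l1"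
  have s: "s > 0" using l1 \<open>a > 0\<close> by (simp add: s_def)
  obtain C where C: "\<And>l. l \<ge> a \<Longrightarrow> G l \<le> s / 2 * l + C" using sub[of "s / 2"] s by auto
  \<comment> \<open>Beyond \<open>2 * C / s\<close> the bound \<open>s / 2 * l + C\<close> is below
    \<open>s * l\<close>, so such points cannot beat \<open>l1\<close>; a compact interval
    remains.\<close>
  define L where "L = max l1 (2 * C / s)"
  have cont': "continuous_on {a..L} (\<lambda>l. G l / l)"
    using \<open>a > 0\<close> by (intro continuous_intros continuous_on_subset[OF cont]) auto
  obtain l where l: "l \<in> {a..L}" "\<And>l'. l' \<in> {a..L} \<Longrightarrow> G l' / l' \<le> G l / l"
    using continuous_attains_sup[OF _ _ cont'] l1 by (fastforce simp: L_def)
  have sl: "s \<le> G l / l" using l(2)[of l1] l1 by (simp add: s_def L_def)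
  have "G l' / l' \<le> G l / l" if "l' \<ge> a" for l'
  proof (cases "l' \<le> L")
    case False
    then have "2 * C / s < l'" by (simp add: L_def)
    then have "G l' \<le> s * l'" using C[OF that] s by (simp add: field_simps)
    then have "G l' / l' \<le> s" using that \<open>a > 0\<close> by (simp add: field_simps)
    then show ?thesis using sl by simp
  qed (use l that in auto)
  moreover have "G l > 0" using sl s l(1) \<open>a > 0\<close> by (smt (verit) atLeastAtMost_iff divide_nonpos_pos)
  ultimately show ?thesis using l(1) by auto
qed

locale ergodic_coeffs = ergodic_shift M \<pi> for M :: "'a measure" and \<pi> +
  fixes c d :: "int \<Rightarrow> 'a \<Rightarrow> real" and K :: real
  assumes c_meas [measurable]: "\<And>i. c i \<in> borel_measurable M"
    and d_meas [measurable]: "\<And>i. d i \<in> borel_measurable M"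
    and c_stat: "\<And>i j \<omega>. \<omega> \<in> space M \<Longrightarrow> c (i + j) \<omega> = c i (\<pi> j \<omega>)"
    and d_stat: "\<And>i j \<omega>. \<omega> \<in> space M \<Longrightarrow> d (i + j) \<omega> = d i (\<pi> j \<omega>)"
    and bounded: "\<And>\<omega>. \<omega> \<in> space M \<Longrightarrow> bounded_coeffs (\<lambda>i. c i \<omega>) (\<lambda>i. d i \<omega>) K"
begin

abbreviation rm :: "real \<Rightarrow> 'a \<Rightarrow> int \<Rightarrow> real" where
  "rm l \<omega> \<equiv> coeffs.minimal_ratio (\<lambda>i. c i \<omega>) (\<lambda>i. d i \<omega>) K l"

abbreviation ad :: "real \<Rightarrow> 'a \<Rightarrow> bool" where
  "ad l \<omega> \<equiv> coeffs.has_supersolutions (\<lambda>i. c i \<omega>) (\<lambda>i. d i \<omega>) l"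

abbreviation fwd :: "real \<Rightarrow> real \<Rightarrow> 'a \<Rightarrow> int \<Rightarrow> nat \<Rightarrow> real" where
  "fwd l Q \<omega> \<equiv> coeffs.forward_riccati (\<lambda>i. c i \<omega>) (\<lambda>i. d i \<omega>) l Q"

abbreviation BK :: "real \<Rightarrow> real" where "BK \<equiv> coeffs.B K"

abbreviation Hl :: "'a \<Rightarrow> real \<Rightarrow> ereal" where "Hl \<omega> \<equiv> H_lower (\<lambda>i. c i \<omega>) (\<lambda>i. d i \<omega>)"

abbreviation Hu :: "'a \<Rightarrow> real \<Rightarrow> ereal" where "Hu \<omega> \<equiv> H_upper (\<lambda>i. c i \<omega>) (\<lambda>i. d i \<omega>)"

section \<open>Stationarity and measurability of the ratios\<close>

lemma shifted_coeffs:
  assumes "\<omega> \<in> space M"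
  shows "(\<lambda>i. c i (\<pi> j \<omega>)) = (\<lambda>i. c (i + j) \<omega>)" "(\<lambda>i. d i (\<pi> j \<omega>)) = (\<lambda>i. d (i + j) \<omega>)"
  by (simp_all add: c_stat[OF assms] d_stat[OF assms])

lemma rm_pi: "\<omega> \<in> space M \<Longrightarrow> rm l (\<pi> j \<omega>) i = rm l \<omega> (i + j)"
  using minimal_ratio_shift[of "\<lambda>i. c i \<omega>" j "\<lambda>i. d i \<omega>" K l i] by (simp only: shifted_coeffs)

lemma fwd_pi: "\<omega> \<in> space M \<Longrightarrow> fwd l Q (\<pi> j \<omega>) a t = fwd l Q \<omega> (a + j) t"
  using forward_riccati_shift_coeffs[of "\<lambda>i. c i \<omega>" j "\<lambda>i. d i \<omega>" l Q a t] by (simp only: shifted_coeffs)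

lemma rm_measurable [measurable]: "(\<lambda>\<omega>. rm l \<omega> i) \<in> borel_measurable M"
proof -
  have "(\<lambda>\<omega>. coeffs.backward_riccati (\<lambda>i. c i \<omega>) (\<lambda>i. d i \<omega>) K l n i) \<in> borel_measurable M" for n
  proof (induction n arbitrary: i)
    case (Suc n)
    note Suc[measurable]
    show ?case unfolding coeffs.backward_riccati.simps coeffs.v_def by measurable
  qed (simp add: coeffs.backward_riccati.simps)
  then show ?thesis unfolding coeffs.minimal_ratio_def by measurable
qed

lemma fwd_measurable [measurable]: "(\<lambda>\<omega>. fwd l Q \<omega> a t) \<in> borel_measurable M"
proof (induction t)
  case (Suc t)
  note Suc[measurable]
  show ?case unfolding coeffs.forward_riccati.simps coeffs.v_def coeffs.riccati_def by measurable
qed (simp add: coeffs.forward_riccati.simps)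

lemma K_ge_1: "K \<ge> 1"
proof -
  obtain \<omega> where "\<omega> \<in> space M" using not_empty by blast
  then show ?thesis using bounded_coeffs.K1 bounded by blast
qed

lemma abs_ln_rm: "\<omega> \<in> space M \<Longrightarrow> \<bar>ln (rm l \<omega> i)\<bar> \<le> ln (BK l)"
  using bounded_coeffs.abs_ln_rmin_le[OF bounded] .

lemma integrable_ln_rm: "integrable M (\<lambda>\<omega>. ln (rm l \<omega> i))"
proof (rule integrable_const_bound[of _ "ln (BK l)"])
  show "AE \<omega> in M. norm (ln (rm l \<omega> i)) \<le> ln (BK l)"
    unfolding real_norm_def by (rule AE_I2) (rule abs_ln_rm)
qed measurable

text \<open>The decay rate of the minimal positive solution: its Lyapunov exponent with the sign
  reversed.\<close>

definition \<gamma> :: "real \<Rightarrow> real" where "\<gamma> l = - expectation (\<lambda>\<omega>. ln (rm l \<omega> 0))"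

lemma AE_rate: "AE \<omega> in M. rate (rm l \<omega>) (- \<gamma> l)"
proof -
  have "AE \<omega> in M. (\<lambda>n. (\<Sum>i<n. ln (rm l (\<pi> (int i) \<omega>) 0)) / real n) \<longlonglongrightarrow> expectation (\<lambda>\<omega>. ln (rm l \<omega> 0))"
    by (rule birkhoff[where C="ln (BK l)"]) (measurable, rule abs_ln_rm)
  moreover have "AE \<omega> in M. \<omega> \<in> space M" by (rule AE_space)
  ultimately show ?thesis
    by eventually_elim (simp add: rate_def \<gamma>_def rm_pi)
qed

lemma ad_mono: "\<omega> \<in> space M \<Longrightarrow> ad l \<omega> \<Longrightarrow> l \<le> l' \<Longrightarrow> ad l' \<omega>"
  by (rule bounded_coeffs.has_supersolutions_mono[OF bounded])

section \<open>The threshold level and the decay rate as a function of the level\<close>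

definition levels :: "real set" where "levels = {l. AE \<omega> in M. ad l \<omega>}"

lemma levels_up: "l \<in> levels \<Longrightarrow> l \<le> l' \<Longrightarrow> l' \<in> levels"
  unfolding levels_def mem_Collect_eq
  by (rule AE_mp, assumption, rule AE_I2) (simp add: ad_mono)

lemma levels_const:
  assumes "0 < \<rho>" "K * \<rho> + K / \<rho> \<le> l - K"
  shows "l \<in> levels" "\<gamma> l \<ge> - ln \<rho>"
proof -
  note * = bounded_coeffs.minimal_ratio_le_const[OF bounded assms]
  show "l \<in> levels" unfolding levels_def using *(1) by auto
  have "expectation (\<lambda>\<omega>. ln (rm l \<omega> 0)) \<le> expectation (\<lambda>\<omega>. ln \<rho>)"
  proof (rule integral_mono[OF integrable_ln_rm])
    fix \<omega> assume w: "\<omega> \<in> space M"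
    show "ln (rm l \<omega> 0) \<le> ln \<rho>"
      using *(2)[OF w, of 0] bounded_coeffs.minimal_ratio_pos[OF bounded[OF w], of l 0] assms(1) by simp
  qed simp
  then show "\<gamma> l \<ge> - ln \<rho>" by (simp add: \<gamma>_def prob_space)
qed

lemma AE_imp_ex:
  assumes "AE \<omega> in M. P \<omega>"
  obtains \<omega> where "\<omega> \<in> space M" "P \<omega>"
proof (rule ccontr)
  assume "\<not> thesis"
  then have "AE \<omega> in M. \<not> P \<omega>" using that by (intro AE_I2) blast
  with assms have "AE \<omega> in M. False" by eventually_elim simp
  then show False by simp
qed

lemma levels_lower_bound: assumes "l \<in> levels" shows "l \<ge> - 3 * K"
proof -
  obtain \<omega> where w: "\<omega> \<in> space M" "ad l \<omega>"
    using AE_imp_ex[of "ad l"] assms unfolding levels_def by blast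
  interpret b: bounded_coeffs "\<lambda>i. c i \<omega>" "\<lambda>i. d i \<omega>" K by (rule bounded[OF w(1)])
  have "0 < d (0 + 1) \<omega> * rm l \<omega> 0 + d 0 \<omega> / rm l \<omega> (0 - 1)"
    using b.minimal_ratio_pos by (intro add_pos_pos mult_pos_pos divide_pos_pos b.d_pos)
  also have "\<dots> = b.v l 0" by (rule b.minimal_ratio_eq[OF w(2)])
  also have "\<dots> \<le> l + 3 * K" by (rule b.v_le)
  finally show ?thesis by linarith
qed

definition \<Lambda> :: real where "\<Lambda> = Inf levels"

lemma levels_nonempty: "levels \<noteq> {}"
  using levels_const(1)[of 1 "3 * K"] by auto

lemma levels_bdd: "bdd_below levels"
  by (rule bdd_belowI[of _ "- 3 * K"]) (rule levels_lower_bound)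

lemma above_\<Lambda>: "\<Lambda> < l \<Longrightarrow> l \<in> levels"
  unfolding \<Lambda>_def using cInf_lessD[OF levels_nonempty, of l] levels_up[of _ l] by fastforce

text \<open>Countably many levels decreasing to \<open>\<Lambda>\<close> share one exceptional null
  set, so the pointwise right limit reaches \<open>\<Lambda>\<close> itself.\<close>

lemma AE_adm_\<Lambda>: "AE \<omega> in M. ad \<Lambda> \<omega> \<and> (\<lambda>n. rm (\<Lambda> + 1 / real (Suc n)) \<omega> 0) \<longlonglongrightarrow> rm \<Lambda> \<omega> 0"
proof -
  have "AE \<omega> in M. \<forall>n. ad (\<Lambda> + 1 / real (Suc n)) \<omega>"
    unfolding AE_all_countable using above_\<Lambda> by (auto simp: levels_def)
  moreover have "AE \<omega> in M. \<omega> \<in> space M" by (rule AE_space)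
  ultimately show ?thesis
  proof eventually_elim
    case (elim \<omega>)
    interpret b: bounded_coeffs "\<lambda>i. c i \<omega>" "\<lambda>i. d i \<omega>" K by (rule bounded) (use elim in blast)
    show ?case using b.has_supersolutions_right_limit[of \<Lambda>] elim by blast
  qed
qed

lemma in_levels_iff: "l \<in> levels \<longleftrightarrow> \<Lambda> \<le> l"
proof -
  have "\<Lambda> \<in> levels" using AE_adm_\<Lambda> by (auto simp: levels_def elim: eventually_mono)
  then show ?thesis using cInf_lower[OF _ levels_bdd] levels_up unfolding \<Lambda>_def by blast
qed

lemma AE_adm: "AE \<omega> in M. \<omega> \<in> space M \<and> (\<forall>l\<ge>\<Lambda>. ad l \<omega>)"
  using AE_adm_\<Lambda> AE_space by eventually_elim (blast intro: ad_mono)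

lemma \<gamma>_mono: assumes "\<Lambda> \<le> l" "l \<le> l'" shows "\<gamma> l \<le> \<gamma> l'"
proof -
  have "expectation (\<lambda>\<omega>. ln (rm l' \<omega> 0)) \<le> expectation (\<lambda>\<omega>. ln (rm l \<omega> 0))"
  proof (rule integral_mono_AE[OF integrable_ln_rm integrable_ln_rm])
    show "AE \<omega> in M. ln (rm l' \<omega> 0) \<le> ln (rm l \<omega> 0)"
      using AE_adm
    proof eventually_elim
      case (elim \<omega>)
      then interpret b: bounded_coeffs "\<lambda>i. c i \<omega>" "\<lambda>i. d i \<omega>" K by (intro bounded) blast
      show ?case using b.minimal_ratio_antimono[of l l' 0] b.minimal_ratio_pos elim assms by simp
    qed
  qed
  then show ?thesis by (simp add: \<gamma>_def)
qed

lemma \<gamma>_concave: "convex_on {\<Lambda>..} (\<lambda>l. - \<gamma> l)"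
proof (rule convex_onI)
  fix t l l' :: real assume t: "0 < t" "t < 1" and l: "l \<in> {\<Lambda>..}" "l' \<in> {\<Lambda>..}"
  have "expectation (\<lambda>\<omega>. ln (rm ((1 - t) * l + t * l') \<omega> 0)) \<le>
      expectation (\<lambda>\<omega>. (1 - t) * ln (rm l \<omega> 0) + t * ln (rm l' \<omega> 0))"
  proof (rule integral_mono_AE)
    show "AE \<omega> in M. ln (rm ((1 - t) * l + t * l') \<omega> 0) \<le> (1 - t) * ln (rm l \<omega> 0) + t * ln (rm l' \<omega> 0)"
      using AE_adm
    proof eventually_elim
      case (elim \<omega>)
      then interpret b: bounded_coeffs "\<lambda>i. c i \<omega>" "\<lambda>i. d i \<omega>" K by (intro bounded) blast
      show ?case using b.ln_rmin_concave[of l l' t 0] t l elim by simp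
    qed
  qed (intro integrable_ln_rm Bochner_Integration.integrable_add integrable_mult_right)+
  also have "\<dots> = (1 - t) * expectation (\<lambda>\<omega>. ln (rm l \<omega> 0)) + t * expectation (\<lambda>\<omega>. ln (rm l' \<omega> 0))"
    using integrable_ln_rm by simp
  finally show "- \<gamma> ((1 - t) *\<^sub>R l + t *\<^sub>R l') \<le> (1 - t) * - \<gamma> l + t * - \<gamma> l'"
    by (simp add: \<gamma>_def)
qed simp

text \<open>Concavity gives continuity only in the interior. At \<open>\<Lambda>\<close> a jump is
  excluded by dominated convergence along \<open>\<Lambda> + 1 / real (Suc n)\<close>, together with
  monotonicity.\<close>

lemma \<gamma>_continuous: "continuous_on {\<Lambda>..} \<gamma>"
proof -
  have "continuous_on {\<Lambda><..} (\<lambda>l. - \<gamma> l)"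
    by (rule convex_on_continuous) (auto intro: convex_on_subset[OF \<gamma>_concave])
  then have "continuous_on {\<Lambda><..} (\<lambda>l. - (- \<gamma> l))" by (rule continuous_on_minus)
  then have int: "isCont \<gamma> l" if "l > \<Lambda>" for l
    using that by (simp add: continuous_on_eq_continuous_at)
  have "(\<lambda>n. expectation (\<lambda>\<omega>. ln (rm (\<Lambda> + 1 / real (Suc n)) \<omega> 0))) \<longlonglongrightarrow> expectation (\<lambda>\<omega>. ln (rm \<Lambda> \<omega> 0))"
  proof (rule integral_dominated_convergence[where w="\<lambda>_. ln (BK (\<bar>\<Lambda>\<bar> + 1))"])
    show "AE \<omega> in M. (\<lambda>n. ln (rm (\<Lambda> + 1 / real (Suc n)) \<omega> 0)) \<longlonglongrightarrow> ln (rm \<Lambda> \<omega> 0)"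
      using AE_adm_\<Lambda> AE_space
    proof eventually_elim
      case (elim \<omega>)
      then show ?case using less_imp_neq[OF bounded_coeffs.minimal_ratio_pos[OF bounded[OF elim(2)], of \<Lambda> 0]]
        by (intro tendsto_ln) auto
    qed
    show "AE \<omega> in M. norm (ln (rm (\<Lambda> + 1 / real (Suc n)) \<omega> 0)) \<le> ln (BK (\<bar>\<Lambda>\<bar> + 1))" for n
    proof (rule AE_I2)
      fix \<omega> assume w: "\<omega> \<in> space M"
      interpret b: bounded_coeffs "\<lambda>i. c i \<omega>" "\<lambda>i. d i \<omega>" K by (rule bounded[OF w])
      have "0 \<le> 1 / real (Suc n)" "1 / real (Suc n) \<le> 1" by (auto simp: field_simps)
      then have "\<bar>\<Lambda> + 1 / real (Suc n)\<bar> \<le> \<bar>\<bar>\<Lambda>\<bar> + 1\<bar>" by linarith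
      then have "BK (\<Lambda> + 1 / real (Suc n)) \<le> BK (\<bar>\<Lambda>\<bar> + 1)"
        unfolding coeffs.B_def using K_ge_1 by (intro mult_left_mono) auto
      then have "ln (BK (\<Lambda> + 1 / real (Suc n))) \<le> ln (BK (\<bar>\<Lambda>\<bar> + 1))"
        using b.B_pos by (subst ln_le_cancel_iff) auto
      then show "norm (ln (rm (\<Lambda> + 1 / real (Suc n)) \<omega> 0)) \<le> ln (BK (\<bar>\<Lambda>\<bar> + 1))"
        using abs_ln_rm[OF w, of "\<Lambda> + 1 / real (Suc n)" 0] unfolding real_norm_def by (rule order_trans[rotated])
    qed
  qed auto
  then have lim: "(\<lambda>n. \<gamma> (\<Lambda> + 1 / real (Suc n))) \<longlonglongrightarrow> \<gamma> \<Lambda>"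
    unfolding \<gamma>_def by (rule tendsto_minus)
  show ?thesis
  proof (intro ballI continuous_on_eq_continuous_within[THEN iffD2])
    fix l assume l: "l \<in> {\<Lambda>..}"
    show "continuous (at l within {\<Lambda>..}) \<gamma>"
    proof (cases "l = \<Lambda>")
      case False
      then have "isCont \<gamma> l" using l by (intro int) auto
      then show ?thesis by (rule continuous_at_imp_continuous_at_within)
    next
      case True
      show ?thesis unfolding True continuous_within
      proof (rule order_tendstoI)
        fix a assume "a < \<gamma> \<Lambda>"
        then have "a < \<gamma> x" if "x \<in> {\<Lambda>..}" for x using \<gamma>_mono[of \<Lambda> x] that by simp
        then show "\<forall>\<^sub>F x in at \<Lambda> within {\<Lambda>..}. a < \<gamma> x"
          unfolding eventually_at by (intro exI[of _ 1]) auto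
      next
        fix a assume "\<gamma> \<Lambda> < a"
        then have "\<forall>\<^sub>F n in sequentially. \<gamma> (\<Lambda> + 1 / real (Suc n)) < a"
          using lim by (rule order_tendstoD(2)[rotated])
        then obtain n where n: "\<gamma> (\<Lambda> + 1 / real (Suc n)) < a" by (auto simp: eventually_sequentially)
        have "\<gamma> x < a" if "x \<in> {\<Lambda>..}" "dist x \<Lambda> < 1 / real (Suc n)" for x
          using \<gamma>_mono[of x "\<Lambda> + 1 / real (Suc n)"] n that by (simp add: dist_real_def)
        then show "\<forall>\<^sub>F x in at \<Lambda> within {\<Lambda>..}. \<gamma> x < a"
          unfolding eventually_at by (intro exI[of _ "1 / real (Suc n)"]) auto
      qed
    qed
  qed
qed

lemma \<gamma>_upper: "\<gamma> l \<le> ln (BK l)"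
proof -
  have "expectation (\<lambda>\<omega>. - ln (BK l)) \<le> expectation (\<lambda>\<omega>. ln (rm l \<omega> 0))"
  proof (rule integral_mono[OF _ integrable_ln_rm])
    show "- ln (BK l) \<le> ln (rm l \<omega> 0)" if "\<omega> \<in> space M" for \<omega>
      using abs_ln_rm[OF that, of l 0] by linarith
  qed simp
  then show ?thesis by (simp add: \<gamma>_def prob_space)
qed

lemma \<gamma>_sublinear:
  assumes "\<Lambda> > 0" "s > 0"
  shows "\<exists>C. \<forall>l\<ge>\<Lambda>. \<gamma> l \<le> s * l + C"
proof -
  \<comment> \<open>With this scaling \<open>e * BK l = s * (l + 3 * K)\<close>, and
    \<open>ln x \<le> x - 1\<close> at \<open>x = e * BK l\<close> gives slope exactly
    \<open>s\<close>.\<close>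
  define e where "e = s / K"
  have e: "e > 0" "e * K = s" using assms K_ge_1 by (auto simp: e_def)
  have "\<gamma> l \<le> s * l + (3 * K * s - ln e)" if "l \<ge> \<Lambda>" for l
  proof -
    have "BK l > 0"
      using that assms K_ge_1 unfolding coeffs.B_def by (intro mult_pos_pos add_pos_pos) auto
    then have "ln e + ln (BK l) \<le> e * BK l - 1" using e ln_le_minus_one[of "e * BK l"] by (simp add: ln_mult)
    moreover have "e * BK l = s * (l + 3 * K)"
      using that assms e(2) unfolding coeffs.B_def by (simp add: mult.assoc[symmetric])
    ultimately show ?thesis using \<gamma>_upper[of l] by (simp add: algebra_simps)
  qed
  then show ?thesis by blast
qed

lemma \<gamma>_unbounded: "\<exists>l\<ge>\<Lambda>. \<gamma> l \<ge> x"
proof -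
  define \<rho> l where "\<rho> = exp (- x)" and "l = K * \<rho> + K / \<rho> + K"
  have "\<rho> > 0" by (simp add: \<rho>_def)
  then have "l \<in> levels" "\<gamma> l \<ge> - ln \<rho>" using levels_const[of \<rho> l] by (auto simp: l_def)
  then show ?thesis using in_levels_iff by (auto simp: \<rho>_def)
qed

text \<open>The null set of \<open>AE_rate\<close> depends on the level. Rational levels share one;
  monotonicity of the averages in the level and continuity of \<open>\<gamma>\<close> sandwich the
  others. The endpoint \<open>\<Lambda>\<close> has no approximation from the left within the range
  of monotonicity and is added by hand.\<close>

lemma AE_rate_all: "AE \<omega> in M. \<forall>l\<ge>\<Lambda>. rate (rm l \<omega>) (- \<gamma> l)"
proof -
  have "AE \<omega> in M. \<forall>l::rat. rate (rm (of_rat l) \<omega>) (- \<gamma> (of_rat l))"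
    unfolding AE_all_countable using AE_rate by blast
  then show ?thesis using AE_rate[of \<Lambda>] AE_adm
  proof eventually_elim
    case (elim \<omega>)
    interpret b: bounded_coeffs "\<lambda>i. c i \<omega>" "\<lambda>i. d i \<omega>" K by (rule bounded) (use elim in blast)
    define A where "A l n = (\<Sum>i<n. ln (rm l \<omega> (int i))) / real n" for l n
    have Amono: "A l' n \<le> A l n" if "\<Lambda> \<le> l" "l \<le> l'" for l l' n
      unfolding A_def using that elim b.minimal_ratio_antimono[of l l'] b.minimal_ratio_pos
      by (intro divide_right_mono sum_mono) auto
    have Arat: "A (of_rat q) \<longlonglongrightarrow> - \<gamma> (of_rat q)" for q
      using elim(1) unfolding rate_def A_def[abs_def] by blast
    show ?case
    proof (intro allI impI)
      fix l assume l: "l \<ge> \<Lambda>"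
      show "rate (rm l \<omega>) (- \<gamma> l)"
      proof (cases "l = \<Lambda>")
        case False
        then have l: "l > \<Lambda>" using l by simp
        then have cont: "isCont \<gamma> l"
          using \<gamma>_continuous continuous_on_interior[of "{\<Lambda>..}" \<gamma> l] by simp
        have "A l \<longlonglongrightarrow> - \<gamma> l"
        proof (rule order_tendstoI)
          fix a assume "a < - \<gamma> l"
          then have "\<forall>\<^sub>F x in at l. \<gamma> x < - a"
            using cont unfolding isCont_def by (intro order_tendstoD(2)) auto
          then obtain e where e: "e > 0" "\<And>x. x \<noteq> l \<Longrightarrow> dist x l < e \<Longrightarrow> \<gamma> x < - a"
            by (auto simp: eventually_at)
          obtain q where q: "l < of_rat q" "of_rat q < l + e" using of_rat_dense[of l "l + e"] e by auto
          then have "a < - \<gamma> (of_rat q)" using e(2)[of "of_rat q"] by (simp add: dist_real_def)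
          then have "\<forall>\<^sub>F n in sequentially. a < A (of_rat q) n" using Arat by (rule order_tendstoD(1)[rotated])
          then show "\<forall>\<^sub>F n in sequentially. a < A l n"
            by eventually_elim (use Amono[of l "of_rat q"] l q in \<open>force intro: less_le_trans\<close>)
        next
          fix a assume "- \<gamma> l < a"
          then have "\<forall>\<^sub>F x in at l. \<gamma> x > - a"
            using cont unfolding isCont_def by (intro order_tendstoD(1)) auto
          then obtain e where e: "e > 0" "\<And>x. x \<noteq> l \<Longrightarrow> dist x l < e \<Longrightarrow> \<gamma> x > - a"
            by (auto simp: eventually_at)
          obtain q where q: "max \<Lambda> (l - e) < of_rat q" "of_rat q < l"
            using of_rat_dense[of "max \<Lambda> (l - e)" l] e l by auto
          then have "- \<gamma> (of_rat q) < a" using e(2)[of "of_rat q"] by (simp add: dist_real_def)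
          then have "\<forall>\<^sub>F n in sequentially. A (of_rat q) n < a" using Arat by (rule order_tendstoD(2)[rotated])
          then show "\<forall>\<^sub>F n in sequentially. A l n < a"
            by eventually_elim (use Amono[of "of_rat q" l] q in \<open>force intro: le_less_trans\<close>)
        qed
        then show ?thesis unfolding rate_def A_def[abs_def] .
      qed (use elim in simp)
    qed
  qed
qed

lemma AE_H_at_\<gamma>: "AE \<omega> in M. \<forall>l\<ge>\<Lambda>. Hl \<omega> (- \<gamma> l) = ereal l \<and> Hu \<omega> (- \<gamma> l) = ereal l"
  using AE_rate_all AE_adm
proof eventually_elim
  case (elim \<omega>)
  then interpret b: bounded_coeffs "\<lambda>i. c i \<omega>" "\<lambda>i. d i \<omega>" K by (intro bounded) blast
  show ?case using b.H_eq_of_rmin_rate elim by blast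
qed

text \<open>By \<open>forward_riccati_shift\<close> the event of never hitting is forward invariant,
  so its probability is \<open>0\<close> or \<open>1\<close>. Were it \<open>1\<close>, starts at
  all sites would give supersolutions on all half-lines almost surely, contradicting
  \<open>l < \<Lambda>\<close>.\<close>

lemma hits_with_positive_probability:
  assumes l: "l < \<Lambda>" and Q: "Q \<ge> BK l"
  shows "\<exists>m. prob {\<omega> \<in> space M. fwd l Q \<omega> 0 m = 1 / Q} > 0"
proof -
  define E where "E = {\<omega> \<in> space M. \<forall>t. fwd l Q \<omega> 0 t > 1 / Q}"
  have E_meas: "E \<in> sets M" unfolding E_def by measurable
  have "\<pi> 1 \<omega> \<in> E" if "\<omega> \<in> E" for \<omega>
  proof -
    have w: "\<omega> \<in> space M" using that by (simp add: E_def)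
    interpret b: bounded_coeffs "\<lambda>i. c i \<omega>" "\<lambda>i. d i \<omega>" K by (rule bounded[OF w])
    have "1 / Q < fwd l Q \<omega> (0 + 1) t" for t
      using that b.forward_riccati_shift[OF Q, of 0 t] unfolding E_def by (blast intro: less_le_trans)
    then show ?thesis using w by (simp add: E_def fwd_pi)
  qed
  then have "prob E = 0 \<or> prob E = 1" by (rule zero_one_forward_invariant[OF E_meas])
  moreover have "prob E \<noteq> 1"
  proof
    assume "prob E = 1"
    then have "AE \<omega> in M. \<omega> \<in> E" using AE_prob_1 by blast
    then have "AE \<omega> in M. \<forall>i. \<pi> i \<omega> \<in> E" by (rule AE_pi)
    then have "AE \<omega> in M. ad l \<omega>" using AE_space
    proof eventually_elim
      case (elim \<omega>)
      interpret b: bounded_coeffs "\<lambda>i. c i \<omega>" "\<lambda>i. d i \<omega>" K by (rule bounded) (use elim in blast)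
      have "1 / Q < fwd l Q \<omega> i t" for i t using elim(1)[rule_format, of i] elim(2) by (simp add: E_def fwd_pi)
      then show ?case unfolding b.has_supersolutions_def using b.forward_riccati_super[OF Q] by blast
    qed
    then show False using l in_levels_iff[of l] by (simp add: levels_def)
  qed
  ultimately have "prob E = 0" by blast
  show ?thesis
  proof (rule ccontr)
    assume "\<nexists>m. prob {\<omega> \<in> space M. fwd l Q \<omega> 0 m = 1 / Q} > 0"
    then have "prob {\<omega> \<in> space M. fwd l Q \<omega> 0 m = 1 / Q} = 0" for m
      by (metis (no_types, lifting) measure_nonneg order_le_less)
    then have "AE \<omega> in M. \<not> fwd l Q \<omega> 0 m = 1 / Q" for m
      by (subst (asm) prob_Collect_eq_0) auto
    then have "AE \<omega> in M. \<forall>m. fwd l Q \<omega> 0 m \<noteq> 1 / Q" by (simp add: AE_all_countable)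
    then have "AE \<omega> in M. \<omega> \<in> E" using AE_space
    proof eventually_elim
      case (elim \<omega>)
      have "fwd l Q \<omega> 0 t \<ge> 1 / Q" for t by (rule bounded_coeffs.forward_riccati_ge[OF bounded[OF elim(2)] Q])
      moreover have "fwd l Q \<omega> 0 t \<noteq> 1 / Q" for t using elim(1) by blast
      ultimately have "fwd l Q \<omega> 0 t > 1 / Q" for t by (metis order_le_less)
      then show ?case using elim(2) by (simp add: E_def)
    qed
    then have "prob E = 1" using prob_eq_1[OF E_meas] by simp
    then show False using \<open>prob E = 0\<close> by simp
  qed
qed

lemma AE_H_lower_below:
  assumes l: "l < \<Lambda>"
  shows "AE \<omega> in M. \<forall>q. ereal l \<le> Hl \<omega> q"
proof -
  \<comment> \<open>The rate \<open>q\<close> requires \<open>ln Q > \<bar>q\<bar>\<close>.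
    Restricting \<open>Q\<close> to the naturals leaves countably many null sets, so one event of
    full measure serves all real \<open>q\<close>.\<close>
  have "AE \<omega> in M. real k \<ge> BK l \<longrightarrow> (\<forall>\<kappa>>0. \<exists>C\<ge>0. \<forall>a t. fwd l (real k) \<omega> (int a) t > 1 / real k \<longrightarrow> real t \<le> \<kappa> * real a + C)" for k
  proof (cases "real k \<ge> BK l")
    case True
    obtain m where m: "prob {\<omega> \<in> space M. fwd l (real k) \<omega> 0 m = 1 / real k} > 0"
      using hits_with_positive_probability[OF l True] by blast
    define E where "E = {\<omega> \<in> space M. fwd l (real k) \<omega> 0 m = 1 / real k}"
    have E: "E \<in> sets M" unfolding E_def by measurable
    have "AE \<omega> in M. (\<lambda>n. (\<Sum>i<n. indicator E (\<pi> (int i) \<omega>)) / real n) \<longlonglongrightarrow> expectation (indicator E)"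
      by (rule birkhoff[where C=1]) (use E in \<open>auto simp: indicator_def\<close>)
    moreover have "expectation (indicator E) = prob E" using E by simp
    ultimately have "AE \<omega> in M. (\<lambda>n. (\<Sum>i<n. indicator E (\<pi> (int i) \<omega>)) / real n) \<longlonglongrightarrow> prob E" by simp
    then show ?thesis using AE_space
    proof eventually_elim
      case (elim \<omega>)
      interpret b: bounded_coeffs "\<lambda>i. c i \<omega>" "\<lambda>i. d i \<omega>" K by (rule bounded) (use elim in blast)
      have "indicator E (\<pi> (int i) \<omega>) = (of_bool (fwd l (real k) \<omega> (int i) m = 1 / real k) :: real)" for i
        using elim(2) by (simp add: E_def indicator_def fwd_pi)
      then show ?case using b.hitting_time_sublinear[OF True, of m "prob E"] elim(1) m by (simp add: E_def)
    qed
  qed simp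
  then have "AE \<omega> in M. \<forall>k. real k \<ge> BK l \<longrightarrow> (\<forall>\<kappa>>0. \<exists>C\<ge>0. \<forall>a t. fwd l (real k) \<omega> (int a) t > 1 / real k \<longrightarrow> real t \<le> \<kappa> * real a + C)"
    unfolding AE_all_countable by blast
  then show ?thesis using AE_space
  proof eventually_elim
    case (elim \<omega>)
    interpret b: bounded_coeffs "\<lambda>i. c i \<omega>" "\<lambda>i. d i \<omega>" K by (rule bounded) (use elim in blast)
    show ?case
    proof
      fix q
      obtain k :: nat where k: "real k > max (BK l) (exp \<bar>q\<bar>)" using reals_Archimedean2 by blast
      moreover have "0 < real k" using k exp_gt_zero[of "\<bar>q\<bar>"] by linarith
      ultimately have "ln (exp \<bar>q\<bar>) < ln (real k)" by (subst ln_less_cancel_iff) auto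
      then show "ereal l \<le> Hl \<omega> q"
        using b.H_lower_ge_greedy[of l "real k" q] elim(1) k by simp
    qed
  qed
qed

lemma AE_H_lower_\<Lambda>: "AE \<omega> in M. \<forall>q. ereal \<Lambda> \<le> Hl \<omega> q"
proof -
  have "AE \<omega> in M. \<forall>n. \<forall>q. ereal (\<Lambda> - 1 / real (Suc n)) \<le> Hl \<omega> q"
    unfolding AE_all_countable[of "\<lambda>n \<omega>. \<forall>q. ereal (\<Lambda> - 1 / real (Suc n)) \<le> Hl \<omega> q"]
    using AE_H_lower_below by simp
  then show ?thesis
  proof eventually_elim
    case (elim \<omega>)
    have "(\<lambda>n. \<Lambda> - 1 / real (Suc n)) \<longlonglongrightarrow> \<Lambda> - 0"
      by (intro tendsto_intros LIMSEQ_inverse_real_of_nat[unfolded inverse_eq_divide])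
    then have "(\<lambda>n. ereal (\<Lambda> - 1 / real (Suc n))) \<longlonglongrightarrow> ereal \<Lambda>" by simp
    then show ?case using elim by (blast intro: LIMSEQ_le_const2)
  qed
qed

theorem AE_speeds:
  assumes pos: "AE \<omega> in M. \<exists>\<delta>>0. \<forall>p. ereal \<delta> \<le> Hl \<omega> p"
  shows "\<exists>w. AE \<omega> in M. is_speed (Hl \<omega>) w \<and> is_speed (Hu \<omega>) w"
proof -
  \<comment> \<open>At the rate \<open>- \<gamma> \<Lambda>\<close> the lower eigenvalue equals
    \<open>\<Lambda>\<close>, so its positive lower bound passes to
    \<open>\<Lambda>\<close>.\<close>
  have "AE \<omega> in M. \<Lambda> > 0"
    using pos AE_H_at_\<gamma>
  proof eventually_elim
    case (elim \<omega>)
    then obtain \<delta> where "\<delta> > 0" "ereal \<delta> \<le> ereal \<Lambda>" by (metis order_refl)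
    then show ?case by simp
  qed
  then have L: "\<Lambda> > 0" by simp
  obtain l where l: "l \<ge> \<Lambda>" "\<gamma> l > 0" and max: "\<And>l'. l' \<ge> \<Lambda> \<Longrightarrow> \<gamma> l' / l' \<le> \<gamma> l / l"
    using ratio_maximizer[OF \<gamma>_continuous L \<gamma>_sublinear[OF L]] \<gamma>_unbounded[of 1]
    by (metis less_le_trans zero_less_one)
  define w where "w = l / \<gamma> l"
  have w: "w > 0" using l L by (simp add: w_def)
  have le: "w * \<gamma> l' \<le> l'" if "l' \<ge> \<Lambda>" for l'
    using max[OF that] that l L by (simp add: w_def field_simps)
  have "AE \<omega> in M. is_speed (Hl \<omega>) w \<and> is_speed (Hu \<omega>) w"
    using AE_H_at_\<gamma> AE_H_lower_\<Lambda> AE_space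
  proof eventually_elim
    case (elim \<omega>)
    interpret b: bounded_coeffs "\<lambda>i. c i \<omega>" "\<lambda>i. d i \<omega>" K by (rule bounded) (use elim in blast)
    have ge: "ereal (w * p) \<le> Hl \<omega> (- p)" if "p > 0" for p
    proof (cases "p \<ge> \<gamma> \<Lambda>")
      case True
      obtain l1 where l1: "l1 \<ge> \<Lambda>" "\<gamma> l1 \<ge> p" using \<gamma>_unbounded by blast
      obtain l' where l': "\<Lambda> \<le> l'" "\<gamma> l' = p"
        using IVT'[of \<gamma> \<Lambda> p l1] True l1 continuous_on_subset[OF \<gamma>_continuous, of "{\<Lambda>..l1}"] by auto
      then have "Hl \<omega> (- p) = ereal l'" using elim(1) by blast
      then show ?thesis using le[OF l'(1)] l'(2) by simp
    next
      case False
      \<comment> \<open>By monotonicity no level at or above \<open>\<Lambda>\<close> has rate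
        \<open>- p\<close> here; the uniform bound \<open>\<Lambda> \<le> Hl \<omega> (- p)\<close>
        replaces the exact value.\<close>
      then have "w * p \<le> w * \<gamma> \<Lambda>" using w by simp
      then have "ereal (w * p) \<le> ereal \<Lambda>" using le[of \<Lambda>] by simp
      then show ?thesis using elim(2) order_trans by blast
    qed
    have quot: "ereal w \<le> H / ereal p" if "ereal (w * p) \<le> H" "p > 0" for H p
      using that by (cases H) (auto simp: field_simps)
    have "ereal l / ereal (\<gamma> l) = ereal w" using l by (simp add: w_def)
    then show ?case unfolding is_speed_def
      using quot ge order_trans[OF ge b.H_lower_le_H_upper] elim(1) l by metis
  qed
  then show ?thesis by blast
qed

end

section \<open>Reduction to uniformly bounded coefficients\<close>

lemma admissible_coeffs_bounded:
  assumes "admissible_coeffs g d"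
  shows "\<exists>N. \<forall>i. \<bar>deriv01 (g i) 0\<bar> \<le> real (Suc N) \<and> 1 / real (Suc N) \<le> d i \<and> d i \<le> real (Suc N)"
proof -
  have "0 < (INF i. ereal (d i))" using assms by (simp add: admissible_coeffs_def)
  then obtain a where a: "0 < a" "ereal a < (INF i. ereal (d i))" using ereal_dense2[of 0] by auto
  have da: "a \<le> d i" for i
    using less_INF_D[OF a(2), of i] by simp
  have "(SUP i. ereal (d i)) < \<infinity>" using assms by (simp add: admissible_coeffs_def)
  then obtain b where b: "(SUP i. ereal (d i)) < ereal b" using ereal_dense2 by blast
  have db: "d i \<le> b" for i
    using SUP_lessD[OF b, of i] by simp
  obtain \<alpha> where fin: "(SUP i. C1_Holder_norm \<alpha> (g i)) < \<infinity>"
    using assms by (auto simp: admissible_coeffs_def)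
  define m where "m = enn2real (SUP i. C1_Holder_norm \<alpha> (g i))"
  have m: "(SUP i. C1_Holder_norm \<alpha> (g i)) = ennreal m" using fin by (simp add: m_def)
  have dm: "\<bar>deriv01 (g i) 0\<bar> \<le> m" for i
  proof -
    have le: "C1_Holder_norm \<alpha> (g i) \<le> ennreal m" unfolding m[symmetric] by (rule SUP_upper) simp
    then have "g i differentiable_on {0..1}" by (auto simp: C1_Holder_norm_def top_unique split: if_splits)
    then have "(SUP s\<in>{0..1}. ennreal \<bar>deriv01 (g i) s\<bar>) \<le> C1_Holder_norm \<alpha> (g i)"
      by (simp add: C1_Holder_norm_def add.assoc add_increasing add_increasing2)
    moreover have "ennreal \<bar>deriv01 (g i) 0\<bar> \<le> (SUP s\<in>{0..1}. ennreal \<bar>deriv01 (g i) s\<bar>)"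
      by (rule SUP_upper) simp
    ultimately have "ennreal \<bar>deriv01 (g i) 0\<bar> \<le> ennreal m" using le by order
    then show ?thesis by (simp add: m_def)
  qed
  obtain N where N: "real N > max (max b m) (1 / a)" using reals_Archimedean2 by blast
  have "1 / real (Suc N) \<le> a" using N a(1) by (simp add: field_simps)
  moreover have "b \<le> real (Suc N)" "m \<le> real (Suc N)" using N by auto
  ultimately show ?thesis using da db dm by (intro exI[of _ N]) (blast intro: order_trans)
qed

text \<open>Writes the derivative at \<open>0\<close> as a sequential limit of values of the
  coefficient; this is where measurability of \<open>c\<close> on \<open>\<Omega>0\<close> comes
  from.\<close>

lemma admissible_coeffs_deriv:
  assumes "admissible_coeffs g d"
  shows "(\<lambda>n. real (Suc n) * g i (1 / real (Suc n))) \<longlonglongrightarrow> deriv01 (g i) 0"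
proof -
  obtain \<alpha> where "(SUP i. C1_Holder_norm \<alpha> (g i)) < \<infinity>" and g0: "g i 0 = 0"
    using assms by (auto simp: admissible_coeffs_def)
  then have "C1_Holder_norm \<alpha> (g i) < \<infinity>" by (metis SUP_lessD UNIV_I)
  then have "g i differentiable_on {0..1}" by (auto simp: C1_Holder_norm_def split: if_splits)
  then have "g i differentiable (at 0 within {0..1})" by (simp add: differentiable_on_def)
  then have "(g i has_vector_derivative deriv01 (g i) 0) (at 0 within {0..1})"
    unfolding deriv01_def by (simp add: vector_derivative_works[symmetric])
  then have "((\<lambda>y. (g i y - g i 0) / (y - 0)) \<longlongrightarrow> deriv01 (g i) 0) (at 0 within {0..1})"
    by (simp only: has_real_derivative_iff_has_vector_derivative[symmetric] has_field_derivative_iff)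
  moreover have "filterlim (\<lambda>n. 1 / real (Suc n)) (at 0 within {0..1}) sequentially"
    using LIMSEQ_inverse_real_of_nat by (auto simp: filterlim_at inverse_eq_divide field_simps intro!: always_eventually)
  ultimately have "(\<lambda>n. (g i (1 / real (Suc n)) - g i 0) / (1 / real (Suc n) - 0)) \<longlonglongrightarrow> deriv01 (g i) 0"
    by (rule filterlim_compose)
  then show ?thesis by (simp add: g0 mult.commute)
qed

lemma admissible_coeffs_Liminf:
  assumes "admissible_coeffs g d"
  obtains \<delta> n where "\<delta> > 0" "\<And>i. i > n \<Longrightarrow> \<delta> \<le> deriv01 (g i) 0 - (sqrt (d (i + 1)) - sqrt (d i))\<^sup>2"
proof -
  let ?X = "\<lambda>i. ereal (deriv01 (g i) 0 - (sqrt (d (i + 1)) - sqrt (d i))\<^sup>2)"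
  have "0 < Liminf (filtercomap abs at_top) ?X" using assms by (simp add: admissible_coeffs_def)
  then obtain \<delta> where \<delta>: "0 < \<delta>" "ereal \<delta> < Liminf (filtercomap abs at_top) ?X"
    using ereal_dense2[of 0] by auto
  have "\<forall>\<^sub>F i in filtercomap abs at_top. ereal \<delta> < ?X i" by (rule less_LiminfD[OF \<delta>(2)])
  then obtain n where "\<And>i. \<bar>i\<bar> \<ge> n \<Longrightarrow> ereal \<delta> < ?X i" by (auto simp: eventually_filtercomap_at_top_linorder)
  then have "\<delta> \<le> deriv01 (g i) 0 - (sqrt (d (i + 1)) - sqrt (d i))\<^sup>2" if "i > max n 0" for i
    using that by (metis abs_of_pos ereal_less(1) less_eq_ereal_def less_ereal.simps(1) less_imp_le max_less_iff_conj)
  with \<delta>(1) show thesis by (rule that)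
qed

theorem theorem6p1:
  fixes M :: "'a measure"
    and f :: "int \<Rightarrow> real \<Rightarrow> 'a \<Rightarrow> real"
    and d :: "int \<Rightarrow> 'a \<Rightarrow> real"
    and c :: "int \<Rightarrow> 'a \<Rightarrow> real"
    and \<pi> :: "int \<Rightarrow> 'a \<Rightarrow> 'a"
    and \<Omega>0 :: "'a set"
  assumes "prob_space M"
    and "\<And>i s. s \<in> {0..1} \<Longrightarrow> f i s \<in> borel_measurable M"
    and "\<And>i. d i \<in> borel_measurable M"
    and "\<And>i \<omega>. \<omega> \<in> space M \<Longrightarrow> d i \<omega> > 0"
    and "\<Omega>0 \<in> sets M" and "measure M \<Omega>0 = 1"
    and "\<And>\<omega>. \<omega> \<in> \<Omega>0 \<Longrightarrow> admissible_coeffs (\<lambda>i s. f i s \<omega>) (\<lambda>i. d i \<omega>)"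
    and c_def: "c = (\<lambda>i \<omega>. deriv01 (\<lambda>s. f i s \<omega>) 0)"
    and "measure_preserving_Z_action M \<pi>"
    and "ergodic_action M \<pi>"
    and "\<And>i j \<omega>. \<omega> \<in> space M \<Longrightarrow> c (i + j) \<omega> = c i (\<pi> j \<omega>)"
    and "\<And>i j \<omega>. \<omega> \<in> space M \<Longrightarrow> d (i + j) \<omega> = d i (\<pi> j \<omega>)"
  shows "\<exists>\<Omega>'\<in>sets M. measure M \<Omega>' = 1 \<and>
    (\<exists>lower_speed upper_speed.
       (\<forall>\<omega>\<in>\<Omega>'. is_speed (H_lower (\<lambda>i. c i \<omega>) (\<lambda>i. d i \<omega>)) (lower_speed \<omega>) \<and>
                is_speed (H_upper (\<lambda>i. c i \<omega>) (\<lambda>i. d i \<omega>)) (upper_speed \<omega>)) \<and>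
       (\<forall>\<omega>\<in>\<Omega>'. upper_speed \<omega> = lower_speed \<omega>) \<and>
       (\<exists>w. \<forall>\<omega>\<in>\<Omega>'. lower_speed \<omega> = w))"
proof -
  interpret ergodic_shift M \<pi>
    by (rule ergodic_shift.intro[OF assms(1) ergodic_shift_axioms.intro[OF assms(9,10)]])
  note f_meas [measurable] = assms(2) and d_meas [measurable] = assms(3) and \<Omega>0 [measurable] = assms(5)
    and adm = assms(7) and c_stat = assms(11) and d_stat = assms(12)
  \<comment> \<open>Outside \<open>\<Omega>0\<close> the derivative is uncontrolled, so
    \<open>c\<close> itself is not claimed measurable. This version is measurable everywhere and
    agrees with \<open>c\<close> on \<open>\<Omega>0\<close>.\<close>
  define cm where "cm i \<omega> = lim (\<lambda>n. real (Suc n) * f i (1 / real (Suc n)) \<omega>)" for i \<omega>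
  have cm_meas [measurable]: "cm i \<in> borel_measurable M" for i
  proof -
    have "f i (1 / real (Suc n)) \<in> borel_measurable M" for n by (rule f_meas) (simp add: field_simps)
    note this[measurable]
    show ?thesis unfolding cm_def[abs_def] by measurable
  qed
  have cm: "cm i \<omega> = c i \<omega>" if "\<omega> \<in> \<Omega>0" for i \<omega>
    unfolding cm_def c_def using admissible_coeffs_deriv[OF adm[OF that], of i] by (rule limI)
  \<comment> \<open>Requiring the whole orbit to stay in \<open>\<Omega>0\<close> and the bounds at
    all sites makes \<open>G N\<close> invariant. These sets cover almost every event, so the
    zero-one law gives one of them probability \<open>1\<close>.\<close>
  define G where "G N = {\<omega> \<in> space M. (\<forall>j. \<pi> j \<omega> \<in> \<Omega>0) \<and>
    (\<forall>i. \<bar>c i \<omega>\<bar> \<le> real (Suc N) \<and> 1 / real (Suc N) \<le> d i \<omega> \<and> d i \<omega> \<le> real (Suc N))}" for N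
  have G\<Omega>0: "\<omega> \<in> \<Omega>0" "\<omega> \<in> space M" if "\<omega> \<in> G N" for \<omega> N
  proof -
    show "\<omega> \<in> space M" using that by (simp add: G_def)
    then show "\<omega> \<in> \<Omega>0" using that pi_0[of \<omega>] unfolding G_def by (metis (mono_tags, lifting) mem_Collect_eq)
  qed
  have "G N = {\<omega> \<in> space M. (\<forall>j. \<pi> j \<omega> \<in> \<Omega>0) \<and>
    (\<forall>i. \<bar>cm i \<omega>\<bar> \<le> real (Suc N) \<and> 1 / real (Suc N) \<le> d i \<omega> \<and> d i \<omega> \<le> real (Suc N))}" for N
    unfolding G_def
  proof (rule Collect_cong, rule conj_cong[OF refl], rule conj_cong[OF refl])
    fix \<omega> assume "\<omega> \<in> space M" "\<forall>j. \<pi> j \<omega> \<in> \<Omega>0"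
    then have "\<omega> \<in> \<Omega>0" using pi_0[of \<omega>] by metis
    then show "(\<forall>i. \<bar>c i \<omega>\<bar> \<le> real (Suc N) \<and> 1 / real (Suc N) \<le> d i \<omega> \<and> d i \<omega> \<le> real (Suc N)) =
       (\<forall>i. \<bar>cm i \<omega>\<bar> \<le> real (Suc N) \<and> 1 / real (Suc N) \<le> d i \<omega> \<and> d i \<omega> \<le> real (Suc N))"
      by (simp only: cm)
  qed
  then have G_meas [measurable]: "G N \<in> sets M" for N by simp
  have G_inv: "\<pi> j \<omega> \<in> G N" if "\<omega> \<in> G N" for \<omega> j N
    using that unfolding G_def by (simp add: pi_add c_stat[symmetric] d_stat[symmetric])
  have G_iff: "\<pi> j \<omega> \<in> G N \<longleftrightarrow> \<omega> \<in> G N" if "\<omega> \<in> space M" for \<omega> j N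
    using G_inv[of \<omega> N j] G_inv[of "\<pi> j \<omega>" N "- j"] that by (auto simp: pi_add)
  have "AE \<omega> in M. \<omega> \<in> \<Omega>0" using AE_prob_1[OF assms(6)] .
  then have "AE \<omega> in M. \<forall>j. \<pi> j \<omega> \<in> \<Omega>0" by (rule AE_pi)
  then have AE_G: "AE \<omega> in M. \<exists>N. \<omega> \<in> G N"
    using AE_space
  proof eventually_elim
    case (elim \<omega>)
    then have "\<omega> \<in> \<Omega>0" using pi_0[of \<omega>] by metis
    then show ?case using admissible_coeffs_bounded[OF adm[of \<omega>]] elim by (simp add: G_def c_def)
  qed
  have "\<exists>N. prob (G N) = 1"
  proof (rule ccontr)
    assume "\<nexists>N. prob (G N) = 1"
    then have "prob (G N) = 0" for N using zero_one_invariant[OF G_meas, of N] G_iff by blast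
    then have "AE \<omega> in M. \<omega> \<notin> G N" for N using prob_eq_0[OF G_meas] by blast
    then have "AE \<omega> in M. \<forall>N. \<omega> \<notin> G N" by (simp add: AE_all_countable)
    with AE_G have "AE \<omega> in M. False" by eventually_elim blast
    then show False by simp
  qed
  then obtain N where N: "prob (G N) = 1" by blast
  \<comment> \<open>The constant value \<open>1\<close> off \<open>G N\<close> makes the bounds hold
    for every event, and invariance of \<open>G N\<close> preserves stationarity.\<close>
  define c' d' where "c' i \<omega> = (if \<omega> \<in> G N then cm i \<omega> else 1)"
    and "d' i \<omega> = (if \<omega> \<in> G N then d i \<omega> else 1)" for i \<omega>
  have c': "c' i \<omega> = (if \<omega> \<in> G N then c i \<omega> else 1)" for i \<omega>
    using cm G\<Omega>0 by (simp add: c'_def)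
  interpret ergodic_coeffs M \<pi> c' d' "real (Suc N)"
  proof (intro ergodic_coeffs.intro ergodic_coeffs_axioms.intro)
    show "ergodic_shift M \<pi>" by unfold_locales
    show "c' i \<in> borel_measurable M" "d' i \<in> borel_measurable M" for i
      unfolding c'_def[abs_def] d'_def[abs_def] by measurable
    show "c' (i + j) \<omega> = c' i (\<pi> j \<omega>)" "d' (i + j) \<omega> = d' i (\<pi> j \<omega>)" if "\<omega> \<in> space M" for i j \<omega>
      using that by (simp_all add: c' d'_def G_iff c_stat d_stat)
    show "bounded_coeffs (\<lambda>i. c' i \<omega>) (\<lambda>i. d' i \<omega>) (real (Suc N))" for \<omega>
      by unfold_locales (auto simp: c' d'_def G_def field_simps)
  qed
  have "AE \<omega> in M. \<omega> \<in> G N" using AE_prob_1[OF N] .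
  moreover from this have "AE \<omega> in M. \<exists>\<delta>>0. \<forall>p. ereal \<delta> \<le> H_lower (\<lambda>i. c' i \<omega>) (\<lambda>i. d' i \<omega>) p"
  proof eventually_elim
    case (elim \<omega>)
    interpret b: bounded_coeffs "\<lambda>i. c' i \<omega>" "\<lambda>i. d' i \<omega>" "real (Suc N)" by (rule bounded[OF G\<Omega>0(2)[OF elim]])
    obtain \<delta> n where "\<delta> > 0" "\<And>i. i > n \<Longrightarrow> \<delta> \<le> c i \<omega> - (sqrt (d (i + 1) \<omega>) - sqrt (d i \<omega>))\<^sup>2"
      unfolding c_def using admissible_coeffs_Liminf[OF adm[OF G\<Omega>0(1)[OF elim]]] by blast
    then show ?case using b.H_lower_ge_of_Liminf[of n \<delta>] elim by (auto simp: c' d'_def)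
  qed
  then obtain w where "AE \<omega> in M. is_speed (H_lower (\<lambda>i. c' i \<omega>) (\<lambda>i. d' i \<omega>)) w \<and>
      is_speed (H_upper (\<lambda>i. c' i \<omega>) (\<lambda>i. d' i \<omega>)) w"
    using AE_speeds by blast
  ultimately have "AE \<omega> in M. is_speed (H_lower (\<lambda>i. c i \<omega>) (\<lambda>i. d i \<omega>)) w \<and>
      is_speed (H_upper (\<lambda>i. c i \<omega>) (\<lambda>i. d i \<omega>)) w"
    by eventually_elim (simp add: c' d'_def)
  \<comment> \<open>The set on which the speeds exist need not be measurable, so the complement of a
    measurable null set is taken instead.\<close>
  then obtain Z where Z: "\<And>\<omega>. \<omega> \<in> space M - Z \<Longrightarrow> is_speed (H_lower (\<lambda>i. c i \<omega>) (\<lambda>i. d i \<omega>)) w \<and>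
      is_speed (H_upper (\<lambda>i. c i \<omega>) (\<lambda>i. d i \<omega>)) w" "Z \<in> null_sets M"
    by (rule AE_E3) blast
  have Zs: "Z \<in> sets M" "prob Z = 0" using Z(2) by (auto simp: null_sets_def measure_def)
  show ?thesis
  proof (intro bexI[of _ "space M - Z"] conjI exI[of _ "\<lambda>_. w"])
    show "prob (space M - Z) = 1" using prob_compl[OF Zs(1)] Zs(2) by simp
  qed (use Z(1) Zs(1) in auto)
qed

end
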